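(* For all integers $k\ge 8$ and $t\ge 3$, setting $n=2k(3t-2)$, there exists a cake-cutting instance with $n$ players that exhibits an $\alpha$-dumping paradox with respect to the utilitarian welfare (for connected divisions) with $$\alpha \ \ge\ \frac{kt+2t}{k+3t}.$$ Moreover, the envy-free partial division witnessing this leaves unallocated exactly $k(t-1)$ intervals. In particular (taking $t=k$), there is a constant $c>0$ such that for infinitely many $n$ there is an instance with $n$ players exhibiting a utilitarian $\alpha$-dumping paradox with $\alpha\ge c\sqrt{n}$.
   Context: A cake is the interval $[0,1]$. There are $n$ players $1,\dots,n$; each player $i$ has a valuation $v_i$, a nonatomic countably additive probability measure on the Borel subsets of $[0,1]$. A (connected) division $x$ is a sequence $(X_1,\dots,X_n)$ of pairwise disjoint open intervals of $[0,1]$ (possibly empty), $X_i$ being the piece of player $i$; it is complete if the union of the closures of the $X_i$ equals $[0,1]$, and partial otherwise. Write $u_i(x,j)=v_i(X_j)$. $x$ is envy-free if $u_i(x,i)\ge u_i(x,j)$ for all $i,j$. Utilitarian welfare: $u(x)=\sum_i u_i(x,i)$. For a welfare function $w$ and $\alpha>1$, an instance exhibits an $\alpha$-dumping paradox with respect to $w$ if there exists an envy-free partial division $y$ such that $w(y)\ge \alpha\,w(x)$ for every envy-free complete division $x$. *)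

theory Defs
  imports "HOL-Analysis.Analysis" "HOL-Probability.Probability"
begin

definition valuation :: "real measure \<Rightarrow> bool" where
  "valuation M \<longleftrightarrow> prob_space M \<and> sets M = sets (restrict_space borel {0..1::real})
     \<and> (\<forall>x\<in>{0..1::real}. emeasure M {x} = 0)"

definition cake_instance :: "nat \<Rightarrow> (nat \<Rightarrow> real measure) \<Rightarrow> bool" where
  "cake_instance n v \<longleftrightarrow> (\<forall>i<n. valuation (v i))"

definition open_interval01 :: "real set \<Rightarrow> bool" where
  "open_interval01 X \<longleftrightarrow> (\<exists>a b. 0 \<le> a \<and> b \<le> 1 \<and> X = {a<..<b})"

definition division :: "nat \<Rightarrow> (nat \<Rightarrow> real set) \<Rightarrow> bool" where
  "division n X \<longleftrightarrow> (\<forall>i<n. open_interval01 (X i))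
     \<and> (\<forall>i<n. \<forall>j<n. i \<noteq> j \<longrightarrow> X i \<inter> X j = {})"

definition complete_div :: "nat \<Rightarrow> (nat \<Rightarrow> real set) \<Rightarrow> bool" where
  "complete_div n X \<longleftrightarrow> division n X \<and> (\<Union>i<n. closure (X i)) = {0..1}"

definition partial_div :: "nat \<Rightarrow> (nat \<Rightarrow> real set) \<Rightarrow> bool" where
  "partial_div n X \<longleftrightarrow> division n X \<and> (\<Union>i<n. closure (X i)) \<noteq> {0..1}"

definition envy_free :: "nat \<Rightarrow> (nat \<Rightarrow> real measure) \<Rightarrow> (nat \<Rightarrow> real set) \<Rightarrow> bool" where
  "envy_free n v X \<longleftrightarrow> (\<forall>i<n. \<forall>j<n. measure (v i) (X i) \<ge> measure (v i) (X j))"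

definition util_welfare :: "nat \<Rightarrow> (nat \<Rightarrow> real measure) \<Rightarrow> (nat \<Rightarrow> real set) \<Rightarrow> real" where
  "util_welfare n v X = (\<Sum>i<n. measure (v i) (X i))"

definition unallocated :: "nat \<Rightarrow> (nat \<Rightarrow> real set) \<Rightarrow> real set" where
  "unallocated n X = {0..1} - (\<Union>i<n. closure (X i))"

definition num_unallocated_intervals :: "nat \<Rightarrow> (nat \<Rightarrow> real set) \<Rightarrow> nat" where
  "num_unallocated_intervals n X = card (components (unallocated n X))"

definition dumping_witness :: "nat \<Rightarrow> (nat \<Rightarrow> real measure) \<Rightarrow> real \<Rightarrow> (nat \<Rightarrow> real set) \<Rightarrow> bool" where
  "dumping_witness n v \<alpha> Y \<longleftrightarrow> partial_div n Y \<and> envy_free n v Y \<and>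
     (\<forall>X. complete_div n X \<and> envy_free n v X \<longrightarrow> util_welfare n v Y \<ge> \<alpha> * util_welfare n v X)"

definition util_dumping_paradox :: "nat \<Rightarrow> (nat \<Rightarrow> real measure) \<Rightarrow> real \<Rightarrow> bool" where
  "util_dumping_paradox n v \<alpha> \<longleftrightarrow> \<alpha> > 1 \<and> (\<exists>Y. dumping_witness n v \<alpha> Y)"

end

theory Submission
  imports Defs
begin

text \<open>
  The cake is a row of blocks, each headed by a cell valued by a group of identical fillers; there are as many
  fillers as blocks, so in a complete envy-free division nobody else holds a whole head, and a non-filler
  is confined to one block. Each big player \<open>Big j\<close> has a region with \<open>K + 1\<close> equally valued slots, separated by
  cells \<open>g < K\<close>, the \<open>g\<close>-th of which is worth \<open>x\<close> to the gadget players \<open>Gad g q\<close>, \<open>q \<le> b\<close>. Their other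
  \<open>x\<close>-valued cells are the \<open>b + 1\<close> slots of zone \<open>g\<close>. The controllers \<open>Con m\<close> value every such slot at \<open>x\<close>,
  as well as the tiny crumbs between the slots, and have isolated cells of value \<open>x\<close> of their own.

  Dumping the crumbs lets everyone hold a favourite cell. In a complete envy-free division, suppose that a big
  player holds a whole separating cell \<open>g\<close>. Then the players \<open>Gad g q\<close> get at least \<open>x\<close>, and at most
  \<open>b - 1\<close> of these \<open>b + 1\<close> players can get it from regions, so two of them sit in zone \<open>g\<close>. Hence every controller gets
  at least \<open>x\<close>; there is not enough zone mass for all of them to get more, so each piece is worth
  at most \<open>x\<close> to them. This leaves no owner for the crumbs between the two gadget players. So every separating
  cell is cut, and the big players only get \<open>1 / (K + 1)\<close> each.
\<close>

section \<open>Piecewise uniform valuations\<close>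

definition cell :: "nat \<Rightarrow> nat \<Rightarrow> real set" where
  "cell M c = {real c / real M ..< real (Suc c) / real M}"

text \<open>The factor \<open>real M\<close> makes this the fraction of the cell that lies in
  \<open>A\<close>. The valuations below see a piece only through these fractions, so envy and
  welfare become questions about cells.\<close>

definition overlap :: "nat \<Rightarrow> real set \<Rightarrow> nat \<Rightarrow> real" where
  "overlap M A c = real M * measure lborel (A \<inter> cell M c)"

text \<open>The density \<open>real M * w c\<close> on a cell of length \<open>1 / real M\<close>
  gives cell \<open>c\<close> the mass \<open>w c\<close>.\<close>

definition cell_measure :: "nat \<Rightarrow> (nat \<Rightarrow> real) \<Rightarrow> real measure" where
  "cell_measure M w = restrict_space
     (density lborel (\<lambda>t. \<Sum>c<M. ennreal (real M * w c) * indicator (cell M c) t)) {0..1}"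

lemma cell_borel [measurable]: "cell M c \<in> sets borel"
  by (simp add: cell_def)

lemma cell_subset:
  assumes "c < M"
  shows "cell M c \<subseteq> {0..1}"
proof -
  have "0 \<le> real c / real M" "real (Suc c) / real M \<le> 1"
    using assms by (auto simp: divide_simps)
  then show ?thesis unfolding cell_def
    by (metis atLeastLessThan_subseteq_atLeastAtMost_iff)
qed

lemma emeasure_cell: "M > 0 \<Longrightarrow> emeasure lborel (cell M c) = ennreal (1 / real M)"
  by (simp add: cell_def divide_right_mono diff_divide_distrib[symmetric])

lemma emeasure_Int_cell_finite: "M > 0 \<Longrightarrow> emeasure lborel (A \<inter> cell M c) \<noteq> \<infinity>"
proof -
  assume "M > 0"
  have "emeasure lborel (A \<inter> cell M c) \<le> emeasure lborel (cell M c)"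
    by (intro emeasure_mono) auto
  then show ?thesis using emeasure_cell[OF \<open>M > 0\<close>, of c] by (auto simp: top_unique)
qed

lemma sets_cell_measure: "sets (cell_measure M w) = sets (restrict_space borel {0..1})"
  unfolding cell_measure_def by (intro sets_restrict_space_cong) simp

lemma space_cell_measure: "space (cell_measure M w) = {0..1}"
  by (simp add: cell_measure_def space_restrict_space)

lemma overlap_nonneg [simp]: "0 \<le> overlap M A c"
  by (simp add: overlap_def)

lemma emeasure_cell_measure:
  assumes "M > 0" "\<And>c. 0 \<le> w c" "A \<in> sets borel" "A \<subseteq> {0..1}"
  shows "emeasure (cell_measure M w) A = ennreal (\<Sum>c<M. w c * overlap M A c)"
proof -
  have m: "(\<lambda>t. ennreal (real M * w c) * indicator (cell M c) t) \<in> borel_measurable lborel" for c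
    by measurable
  have *: "ennreal (real M * w c) * emeasure lborel (A \<inter> cell M c) = ennreal (w c * overlap M A c)" for c
  proof -
    have "emeasure lborel (A \<inter> cell M c) = ennreal (measure lborel (A \<inter> cell M c))"
      using emeasure_Int_cell_finite[OF assms(1)] by (simp add: emeasure_eq_ennreal_measure)
    then show ?thesis using assms by (simp add: overlap_def ennreal_mult[symmetric] mult_ac)
  qed
  have "emeasure (cell_measure M w) A =
      emeasure (density lborel (\<lambda>t. \<Sum>c<M. ennreal (real M * w c) * indicator (cell M c) t)) A"
    unfolding cell_measure_def using assms by (intro emeasure_restrict_space) auto
  also have "\<dots> = (\<integral>\<^sup>+t. (\<Sum>c<M. ennreal (real M * w c) * indicator (cell M c) t) * indicator A t \<partial>lborel)"
    using assms by (intro emeasure_density borel_measurable_sum m) auto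
  also have "\<dots> = (\<integral>\<^sup>+t. (\<Sum>c<M. ennreal (real M * w c) * indicator (A \<inter> cell M c) t) \<partial>lborel)"
    by (intro nn_integral_cong) (auto simp: indicator_inter_arith split: split_indicator)
  also have "\<dots> = (\<Sum>c<M. ennreal (real M * w c) * emeasure lborel (A \<inter> cell M c))"
    using assms by (subst nn_integral_sum) (auto simp: nn_integral_cmult_indicator)
  also have "\<dots> = (\<Sum>c<M. ennreal (w c * overlap M A c))" by (simp add: *)
  also have "\<dots> = ennreal (\<Sum>c<M. w c * overlap M A c)"
    using assms by (intro sum_ennreal) auto
  finally show ?thesis .
qed

lemma measure_cell_measure:
  assumes "M > 0" "\<And>c. 0 \<le> w c" "A \<in> sets borel" "A \<subseteq> {0..1}"
  shows "measure (cell_measure M w) A = (\<Sum>c<M. w c * overlap M A c)"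
  using emeasure_cell_measure[OF assms] assms by (simp add: measure_def sum_nonneg)

lemma overlap_superset:
  assumes "M > 0" "cell M c \<subseteq> A"
  shows "overlap M A c = 1"
proof -
  have "A \<inter> cell M c = cell M c" using assms by auto
  then show ?thesis using assms emeasure_cell[OF assms(1), of c]
    by (simp add: overlap_def measure_def)
qed

lemma overlap_0:
  assumes "A \<inter> cell M c = {}"
  shows "overlap M A c = 0"
  using assms by (simp add: overlap_def)

lemma valuation_cell_measure:
  assumes "M > 0" "\<And>c. 0 \<le> w c" "(\<Sum>c<M. w c) = 1"
  shows "valuation (cell_measure M w)"
proof -
  have "emeasure (cell_measure M w) {0..1} = ennreal (\<Sum>c<M. w c * overlap M {0..1} c)"
    using assms by (intro emeasure_cell_measure) auto
  also have "(\<Sum>c<M. w c * overlap M {0..1} c) = 1"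
    using assms by (simp add: overlap_superset cell_subset)
  finally have "prob_space (cell_measure M w)"
    by (intro prob_spaceI) (simp add: space_cell_measure)
  moreover have "emeasure (cell_measure M w) {t} = 0" if "t \<in> {0..1}" for t
  proof -
    have "measure lborel ({t} \<inter> cell M c) = 0" for c
      by (cases "t \<in> cell M c") auto
    then have "overlap M {t} c = 0" for c by (simp add: overlap_def)
    then show ?thesis using assms that by (subst emeasure_cell_measure) auto
  qed
  ultimately show ?thesis by (auto simp: valuation_def sets_cell_measure)
qed

text \<open>Convexity: the interval has a point in \<open>cell M c1\<close> and one in
  \<open>cell M c2\<close>, hence contains everything between them. This is the form in which
  connectedness enters the combinatorial argument.\<close>

lemma overlap_between:
  assumes "M > 0" "X = {a<..<b}" "overlap M X c1 > 0" "overlap M X c2 > 0" "c1 < c" "c < c2"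
  shows "overlap M X c = 1"
proof (rule overlap_superset[OF assms(1)])
  have "X \<inter> cell M c1 \<noteq> {}" "X \<inter> cell M c2 \<noteq> {}"
    using assms(3,4) overlap_0 by fastforce+
  then obtain s t where s: "s \<in> X" "s \<in> cell M c1" and t: "t \<in> X" "t \<in> cell M c2" by blast
  have "s < real (Suc c1) / real M" "real c2 / real M \<le> t" using s t by (auto simp: cell_def)
  moreover have "real (Suc c1) / real M \<le> real c / real M" "real (Suc c) / real M \<le> real c2 / real M"
    using assms by (auto intro!: divide_right_mono)
  ultimately show "cell M c \<subseteq> X" using s t assms(2) by (auto simp: cell_def)
qed

lemma overlap_open_interval:
  assumes "M > 0"
  shows "overlap M {real l / real M <..< real r / real M} c = (if l \<le> c \<and> c < r then 1 else 0)"
proof (cases "l \<le> c \<and> c < r")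
  case True
  then have le: "real l / real M \<le> real c / real M" "real (Suc c) / real M \<le> real r / real M"
    by (auto intro!: divide_right_mono)
  let ?I = "{real l / real M <..< real r / real M}"
  have "measure lborel (?I \<inter> cell M c) = measure lborel ({real c / real M <..< real (Suc c) / real M})"
  proof (rule measure_eq_AE)
    \<comment> \<open>The cell is half-open, so the two sets can differ only in its left end, a null
      set.\<close>
    have "AE t in lborel. t \<noteq> real c / real M" by (rule AE_lborel_singleton)
    then show "AE t in lborel. (t \<in> ?I \<inter> cell M c) = (t \<in> {real c / real M <..< real (Suc c) / real M})"
      by eventually_elim (use le in \<open>auto simp: cell_def\<close>)
  qed auto
  also have "\<dots> = 1 / real M"
    by (simp add: divide_right_mono diff_divide_distrib[symmetric])
  finally show ?thesis using True assms by (simp add: overlap_def)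
next
  case False
  then consider "c < l" | "r \<le> c" by linarith
  then have "{real l / real M <..< real r / real M} \<inter> cell M c = {}"
  proof cases
    case 1
    then have "real (Suc c) / real M \<le> real l / real M" by (auto intro!: divide_right_mono)
    then show ?thesis by (auto simp: cell_def)
  next
    case 2
    then have "real r / real M \<le> real c / real M" by (auto intro!: divide_right_mono)
    then show ?thesis by (auto simp: cell_def)
  qed
  then show ?thesis using False by (auto simp: overlap_0)
qed

text \<open>Taking closures adds only endpoints of pieces, a finite null set. So the disjoint pieces
  themselves cover almost every point of the cell exactly once.\<close>

lemma sum_overlap_complete:
  assumes "M > 0" "complete_div n X" "c < M"
  shows "(\<Sum>j<n. overlap M (X j) c) = 1"
proof -
  have "\<forall>j<n. \<exists>a b. X j = {a<..<b}"
    using assms(2) unfolding complete_div_def division_def open_interval01_def by blast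
  then obtain a b where X: "\<And>j. j < n \<Longrightarrow> X j = {a j<..<b j}" by metis
  have "cell M c \<subseteq> (\<Union>j<n. closure (X j))"
    using assms cell_subset by (auto simp: complete_div_def)
  also have "\<dots> \<subseteq> (\<Union>j<n. X j) \<union> (a ` {..<n} \<union> b ` {..<n})"
  proof (intro UN_least)
    fix j assume j: "j \<in> {..<n}"
    have "closure (X j) \<subseteq> {a j..b j}" using X j by (intro closure_minimal) auto
    also have "\<dots> \<subseteq> X j \<union> {a j, b j}" using X j by auto
    finally show "closure (X j) \<subseteq> (\<Union>j<n. X j) \<union> (a ` {..<n} \<union> b ` {..<n})" using j by blast
  qed
  finally have sub: "cell M c \<subseteq> (\<Union>j<n. X j) \<union> (a ` {..<n} \<union> b ` {..<n})" .
  have fin: "finite (a ` {..<n} \<union> b ` {..<n})" by simp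
  have Xb: "X j \<in> sets borel" if "j < n" for j using X[OF that] by simp
  have "emeasure lborel (cell M c) = emeasure lborel (\<Union>j<n. X j \<inter> cell M c)"
  proof (rule emeasure_eq_AE)
    have "AE t in lborel. t \<notin> (a ` {..<n} \<union> b ` {..<n})"
      by (rule AE_not_in) (simp add: finite_imp_null_set_lborel)
    then show "AE t in lborel. (t \<in> cell M c) = (t \<in> (\<Union>j<n. X j \<inter> cell M c))"
      by eventually_elim (use sub in auto)
  qed (use Xb in auto)
  also have "\<dots> = (\<Sum>j<n. emeasure lborel (X j \<inter> cell M c))"
  proof (rule sum_emeasure[symmetric])
    show "disjoint_family_on (\<lambda>j. X j \<inter> cell M c) {..<n}"
      using assms(2) by (fastforce simp: disjoint_family_on_def complete_div_def division_def)
  qed (use Xb in auto)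
  also have "\<dots> = (\<Sum>j<n. ennreal (measure lborel (X j \<inter> cell M c)))"
    using emeasure_Int_cell_finite[OF assms(1)] by (simp add: emeasure_eq_ennreal_measure)
  also have "\<dots> = ennreal (\<Sum>j<n. measure lborel (X j \<inter> cell M c))" by (intro sum_ennreal) auto
  finally have "(\<Sum>j<n. measure lborel (X j \<inter> cell M c)) = 1 / real M"
    using emeasure_cell[OF assms(1), of c] by (simp add: sum_nonneg)
  then show ?thesis using assms by (simp add: overlap_def sum_distrib_left[symmetric])
qed


section \<open>The instance\<close>

datatype player = Big nat | Gad nat nat | Con nat | Fil nat

definition on_block :: "real \<Rightarrow> nat \<Rightarrow> nat set \<Rightarrow> nat \<Rightarrow> nat \<Rightarrow> real" where
  "on_block c B S \<beta> s = (if \<beta> = B \<and> s \<in> S then c else 0)"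

lemma sum_on_block:
  assumes "B < N" "S \<subseteq> {..<W}"
  shows "(\<Sum>\<beta><N. \<Sum>s<W. on_block c B S \<beta> s * f \<beta> s) = c * sum (f B) S"
proof -
  have "(\<Sum>\<beta><N. \<Sum>s<W. on_block c B S \<beta> s * f \<beta> s) =
      (\<Sum>\<beta><N. if \<beta> = B then \<Sum>s<W. (if s \<in> S then c * f B s else 0) else 0)"
    by (intro sum.cong) (auto simp: on_block_def intro!: sum.cong)
  also have "\<dots> = (\<Sum>s<W. if s \<in> S then c * f B s else 0)" using assms(1) by simp
  also have "\<dots> = (\<Sum>s\<in>S. c * f B s)"
    using assms(2) by (simp add: sum.inter_restrict[symmetric] Int_absorb1)
  finally show ?thesis by (simp add: sum_distrib_left)
qed

text \<open>\<open>L\<close> counts the blocks consisting of a head and worthless cells only. In \<open>z\<close> of them the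
  worthless cells are dumped, merely to adjust the number of unallocated intervals.\<close>

locale dumping_cake =
  fixes b K L z :: nat
  assumes K: "2 \<le> K" and b: "1 \<le> b" and L: "2 * K * Suc b < L + 2 * b" and z: "z \<le> L"
begin

text \<open>All blocks share one width, which exceeds the positions \<open>2 * K + 1\<close> and
  \<open>2 * b + 1\<close> of the last slots in regions and zones.\<close>

definition W :: nat where "W = 2 * K + 2 * b + 2"
text \<open>The order is: \<open>L\<close> plain blocks, \<open>b\<close> regions, \<open>K\<close>
  zones, \<open>K * Suc b\<close> blocks with a controller cell. Plain blocks come first so that a
  non-filler reaching beyond the head of a region or zone cannot touch any plain head.\<close>

definition NB :: nat where "NB = L + b + K + K * Suc b"
definition RB :: "nat \<Rightarrow> nat" where "RB j = L + j"
definition ZB :: "nat \<Rightarrow> nat" where "ZB g = L + b + g"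
definition CB :: "nat \<Rightarrow> nat" where "CB m = L + b + K + m"
text \<open>A controller's total determines \<open>x\<close> and \<open>\<delta>\<close>: there are
  \<open>2 * K * Suc b\<close> cells worth \<open>x\<close>, and the \<open>K * b\<close> crumbs of
  all zones are together worth one more \<open>x\<close>.\<close>

definition x :: real where "x = 1 / (2 * real K * real (Suc b) + 1)"
definition \<delta> :: real where "\<delta> = x / (real K * real b)"
text \<open>What remains to a gadget player after \<open>2 * b + 1\<close> cells worth
  \<open>x\<close> is spread over the \<open>L\<close> plain heads. The assumption on
  \<open>L\<close> makes such a head worth less than \<open>x\<close>.\<close>

definition y :: real where "y = (1 - (2 * real b + 1) * x) / real L"

lemmas block_defs = RB_def ZB_def CB_def NB_def

text \<open>Cell \<open>0\<close> of a block is its head. In zones the crumbs are the even cells between the odd slots, and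
  in regions the even cells separate the big player's odd slots.\<close>

fun weight :: "player \<Rightarrow> nat \<Rightarrow> nat \<Rightarrow> real" where
  "weight (Big j) \<beta> s = on_block (1 / real (Suc K)) (RB j) ((\<lambda>i. Suc (2 * i)) ` {..<Suc K}) \<beta> s"
| "weight (Gad g q) \<beta> s = on_block x (ZB g) ((\<lambda>i. Suc (2 * i)) ` {..<Suc b}) \<beta> s
     + (\<Sum>j<b. on_block x (RB j) {Suc (Suc (2 * g))} \<beta> s) + (\<Sum>\<beta>'<L. on_block y \<beta>' {0} \<beta> s)"
| "weight (Con m) \<beta> s =
     (\<Sum>g<K. on_block x (ZB g) ((\<lambda>i. Suc (2 * i)) ` {..<Suc b}) \<beta> s
        + on_block \<delta> (ZB g) ((\<lambda>i. Suc (Suc (2 * i))) ` {..<b}) \<beta> s)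
     + (\<Sum>m<K * Suc b. on_block x (CB m) {1} \<beta> s)"
| "weight (Fil m) \<beta> s = (\<Sum>\<beta>'<NB. on_block (1 / real NB) \<beta>' {0} \<beta> s)"

definition players :: "player set" where
  "players = Big ` {..<b} \<union> case_prod Gad ` ({..<K} \<times> {..<Suc b}) \<union> Con ` {..<K * Suc b} \<union> Fil ` {..<NB}"

lemma in_players [simp]:
  "Big j \<in> players \<longleftrightarrow> j < b"
  "Gad g q \<in> players \<longleftrightarrow> g < K \<and> q < Suc b"
  "Con m \<in> players \<longleftrightarrow> m < K * Suc b"
  "Fil m \<in> players \<longleftrightarrow> m < NB"
  by (auto simp: players_def)

lemma finite_players [simp]: "finite players"
  by (simp add: players_def)

lemma sum_players:
  "sum f players = (\<Sum>j<b. f (Big j)) + (\<Sum>g<K. \<Sum>q<Suc b. f (Gad g q))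
     + (\<Sum>m<K * Suc b. f (Con m)) + (\<Sum>m<NB. f (Fil m))"
proof -
  have "sum f players = sum f (Big ` {..<b}) + sum f (case_prod Gad ` ({..<K} \<times> {..<Suc b}))
     + sum f (Con ` {..<K * Suc b}) + sum f (Fil ` {..<NB})"
    unfolding players_def by (subst sum.union_disjoint; (auto; fail)?)+
  also have "sum f (Big ` {..<b}) = (\<Sum>j<b. f (Big j))"
    by (subst sum.reindex) (auto simp: inj_on_def)
  also have "sum f (case_prod Gad ` ({..<K} \<times> {..<Suc b})) = (\<Sum>g<K. \<Sum>q<Suc b. f (Gad g q))"
    by (subst sum.reindex) (auto simp: inj_on_def sum.cartesian_product case_prod_unfold simp del: sum.lessThan_Suc)
  also have "sum f (Con ` {..<K * Suc b}) = (\<Sum>m<K * Suc b. f (Con m))"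
    by (subst sum.reindex) (auto simp: inj_on_def)
  also have "sum f (Fil ` {..<NB}) = (\<Sum>m<NB. f (Fil m))"
    by (subst sum.reindex) (auto simp: inj_on_def)
  finally show ?thesis .
qed

lemma card_players: "card players = b + 2 * K * Suc b + NB"
  using sum_players[of "\<lambda>_. 1 :: nat"] by simp

lemma x_pos: "0 < x"
  by (simp add: x_def add_nonneg_pos)

lemma x_total: "(2 * real K * real (Suc b) + 1) * x = 1"
proof -
  have "2 * real K * real (Suc b) + 1 > 0" by (simp add: add_nonneg_pos)
  then show ?thesis by (simp add: x_def)
qed

lemma \<delta>_pos: "0 < \<delta>" and \<delta>_total: "real K * real b * \<delta> = x"
  using K b x_pos by (auto simp: \<delta>_def)

lemma L_pos: "0 < L"
proof -
  have "2 * b \<le> 2 * K * Suc b" using K by (intro mult_le_mono) auto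
  then show ?thesis using L by linarith
qed

lemma y_less: "y < x"
proof -
  have "2 * real K * real (Suc b) + 1 < real L + 2 * real b + 1"
    using L by (metis add_less_cancel_right of_nat_add of_nat_less_iff of_nat_mult of_nat_numeral)
  then have "(2 * real K * real (Suc b) + 1) * x < (real L + 2 * real b + 1) * x"
    using x_pos by (rule mult_strict_right_mono)
  then have "1 - (2 * real b + 1) * x < x * real L"
    using x_total by (simp add: algebra_simps)
  then show ?thesis using L_pos by (simp add: y_def divide_less_eq)
qed

lemma y_nonneg: "0 \<le> y"
proof -
  have "2 * real b + 1 \<le> 2 * real K * real (Suc b) + 1"
    using K by (intro add_right_mono mult_mono) auto
  then have "(2 * real b + 1) * x \<le> (2 * real K * real (Suc b) + 1) * x"
    using x_pos by (intro mult_right_mono) auto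
  then have "(2 * real b + 1) * x \<le> 1" by (simp only: x_total)
  then show ?thesis by (simp add: y_def)
qed

lemma weight_nonneg: "0 \<le> weight i \<beta> s"
  using x_pos \<delta>_pos y_nonneg
  by (cases i) (auto simp: on_block_def intro!: sum_nonneg add_nonneg_nonneg simp del: sum.lessThan_Suc)

text \<open>Here \<open>f\<close> stands for the covered fractions of the cells; the constant 1
  represents the whole cake.\<close>

definition value_of :: "player \<Rightarrow> (nat \<Rightarrow> nat \<Rightarrow> real) \<Rightarrow> real" where
  "value_of i f = (\<Sum>\<beta><NB. \<Sum>s<W. weight i \<beta> s * f \<beta> s)"

lemma value_sum_on_block:
  assumes "\<And>k. k < n \<Longrightarrow> B k < NB" "S \<subseteq> {..<W}"
  shows "(\<Sum>\<beta><NB. \<Sum>s<W. (\<Sum>k<n. on_block c (B k) S \<beta> s) * f \<beta> s) = c * (\<Sum>k<n. sum (f (B k)) S)"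
proof -
  have "(\<Sum>\<beta><NB. \<Sum>s<W. (\<Sum>k<n. on_block c (B k) S \<beta> s) * f \<beta> s)
      = (\<Sum>\<beta><NB. \<Sum>k<n. \<Sum>s<W. on_block c (B k) S \<beta> s * f \<beta> s)"
    unfolding sum_distrib_right by (intro sum.cong refl sum.swap)
  also have "\<dots> = (\<Sum>k<n. \<Sum>\<beta><NB. \<Sum>s<W. on_block c (B k) S \<beta> s * f \<beta> s)" by (rule sum.swap)
  also have "\<dots> = (\<Sum>k<n. c * sum (f (B k)) S)"
    using assms by (intro sum.cong refl sum_on_block) auto
  finally show ?thesis by (simp add: sum_distrib_left)
qed

lemma odd_slots: "sum f ((\<lambda>i. Suc (2 * i)) ` {..<n}) = (\<Sum>i<n. f (Suc (2 * i)))"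
  and even_slots: "sum f ((\<lambda>i. Suc (Suc (2 * i))) ` {..<n}) = (\<Sum>i<n. f (Suc (Suc (2 * i))))"
  by (subst sum.reindex; auto simp: inj_on_def)+

lemma value_Big:
  assumes "j < b"
  shows "value_of (Big j) f = (\<Sum>i<Suc K. f (RB j) (Suc (2 * i))) / real (Suc K)"
  unfolding value_of_def weight.simps
  by (subst sum_on_block) (use assms in \<open>auto simp: block_defs W_def odd_slots simp del: sum.lessThan_Suc\<close>)

lemma value_Gad:
  assumes "g < K"
  shows "value_of (Gad g q) f = x * (\<Sum>i<Suc b. f (ZB g) (Suc (2 * i)))
    + x * (\<Sum>j<b. f (RB j) (Suc (Suc (2 * g)))) + y * (\<Sum>\<beta><L. f \<beta> 0)"
proof -
  have "(\<Sum>\<beta><NB. \<Sum>s<W. on_block x (ZB g) ((\<lambda>i. Suc (2 * i)) ` {..<Suc b}) \<beta> s * f \<beta> s)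
      = x * (\<Sum>i<Suc b. f (ZB g) (Suc (2 * i)))"
    by (subst sum_on_block) (use assms in \<open>auto simp: block_defs W_def odd_slots simp del: sum.lessThan_Suc\<close>)
  moreover have "(\<Sum>\<beta><NB. \<Sum>s<W. (\<Sum>j<b. on_block x (RB j) {Suc (Suc (2 * g))} \<beta> s) * f \<beta> s)
      = x * (\<Sum>j<b. f (RB j) (Suc (Suc (2 * g))))"
    by (subst value_sum_on_block) (use assms in \<open>auto simp: block_defs W_def\<close>)
  moreover have "(\<Sum>\<beta><NB. \<Sum>s<W. (\<Sum>\<beta>'<L. on_block y \<beta>' {0} \<beta> s) * f \<beta> s) = y * (\<Sum>\<beta><L. f \<beta> 0)"
    by (subst value_sum_on_block) (auto simp: block_defs W_def)
  ultimately show ?thesis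
    unfolding value_of_def weight.simps by (simp only: distrib_right sum.distrib)
qed

lemma value_Con:
  "value_of (Con m) f = x * (\<Sum>g<K. \<Sum>i<Suc b. f (ZB g) (Suc (2 * i)))
    + \<delta> * (\<Sum>g<K. \<Sum>i<b. f (ZB g) (Suc (Suc (2 * i)))) + x * (\<Sum>m<K * Suc b. f (CB m) 1)"
proof -
  have "(\<Sum>\<beta><NB. \<Sum>s<W. (\<Sum>g<K. on_block x (ZB g) ((\<lambda>i. Suc (2 * i)) ` {..<Suc b}) \<beta> s) * f \<beta> s)
      = x * (\<Sum>g<K. \<Sum>i<Suc b. f (ZB g) (Suc (2 * i)))"
    by (subst value_sum_on_block) (auto simp: block_defs W_def odd_slots simp del: sum.lessThan_Suc)
  moreover have "(\<Sum>\<beta><NB. \<Sum>s<W. (\<Sum>g<K. on_block \<delta> (ZB g) ((\<lambda>i. Suc (Suc (2 * i))) ` {..<b}) \<beta> s) * f \<beta> s)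
      = \<delta> * (\<Sum>g<K. \<Sum>i<b. f (ZB g) (Suc (Suc (2 * i))))"
    by (subst value_sum_on_block) (auto simp: block_defs W_def even_slots)
  moreover have "(\<Sum>\<beta><NB. \<Sum>s<W. (\<Sum>m<K * Suc b. on_block x (CB m) {1} \<beta> s) * f \<beta> s)
      = x * (\<Sum>m<K * Suc b. f (CB m) 1)"
    by (subst value_sum_on_block) (auto simp: block_defs W_def)
  ultimately show ?thesis
    unfolding value_of_def weight.simps by (simp only: distrib_right sum.distrib)
qed

lemma value_Fil: "value_of (Fil m) f = (\<Sum>\<beta><NB. f \<beta> 0) / real NB"
  unfolding value_of_def weight.simps
  by (subst value_sum_on_block) (auto simp: W_def)

lemma NB_pos: "0 < NB"
  using b by (simp add: NB_def)

lemma total_weight: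
  assumes "i \<in> players"
  shows "value_of i (\<lambda>_ _. 1) = 1"
proof (cases i)
  case (Gad g q)
  have "value_of i (\<lambda>_ _. 1) = x * (2 * real b + 1) + y * real L"
    using assms Gad by (simp add: value_Gad algebra_simps)
  then show ?thesis using L_pos by (simp add: y_def)
next
  case (Con m)
  have "value_of i (\<lambda>_ _. 1) = x * (2 * real K * real (Suc b)) + real K * real b * \<delta>"
    using Con by (simp add: value_Con algebra_simps)
  then show ?thesis using x_total unfolding \<delta>_total by (simp add: algebra_simps)
qed (use assms NB_pos in \<open>auto simp: value_Big value_Fil\<close>)

end


section \<open>Complete envy-free divisions\<close>

definition slot_before :: "nat \<Rightarrow> nat \<Rightarrow> nat \<Rightarrow> nat \<Rightarrow> bool" where
  "slot_before \<beta> s \<beta>' s' \<longleftrightarrow> \<beta> < \<beta>' \<or> \<beta> = \<beta>' \<and> s < s'"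

text \<open>A complete envy-free division, reduced to the fraction \<open>ov i \<beta> s\<close> of
  each cell that player \<open>i\<close> gets: \<open>ov_total\<close> expresses completeness and
  \<open>ov_between\<close> connectedness.\<close>

locale dumping_overlap = dumping_cake +
  fixes ov :: "player \<Rightarrow> nat \<Rightarrow> nat \<Rightarrow> real"
  assumes ov_nonneg: "0 \<le> ov i \<beta> s"
    and ov_total: "\<beta> < NB \<Longrightarrow> s < W \<Longrightarrow> (\<Sum>i\<in>players. ov i \<beta> s) = 1"
    and ov_between: "\<lbrakk>i \<in> players; 0 < ov i \<beta>1 s1; 0 < ov i \<beta>2 s2; slot_before \<beta>1 s1 \<beta> s;
          slot_before \<beta> s \<beta>2 s2; s1 < W; s2 < W; s < W\<rbrakk> \<Longrightarrow> ov i \<beta> s = 1"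
    and envy_free: "\<lbrakk>i \<in> players; j \<in> players\<rbrakk> \<Longrightarrow> value_of i (ov j) \<le> value_of i (ov i)"
begin

lemma ov_le_1:
  assumes "i \<in> players" "\<beta> < NB" "s < W"
  shows "ov i \<beta> s \<le> 1"
  using member_le_sum[of i players "\<lambda>i. ov i \<beta> s"] ov_nonneg ov_total assms by simp

lemma ov_exclusive:
  assumes "i \<in> players" "j \<in> players" "i \<noteq> j" "ov i \<beta> s = 1" "\<beta> < NB" "s < W"
  shows "ov j \<beta> s = 0"
proof -
  have "(\<Sum>k\<in>{i, j}. ov k \<beta> s) \<le> (\<Sum>k\<in>players. ov k \<beta> s)"
    using assms ov_nonneg by (intro sum_mono2) auto
  then show ?thesis using assms ov_total[of \<beta> s] ov_nonneg[of j \<beta> s] by simp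
qed

lemma value_nonneg: "0 \<le> value_of i (ov j)"
  unfolding value_of_def by (intro sum_nonneg mult_nonneg_nonneg weight_nonneg ov_nonneg)

lemma sum_value:
  assumes "i \<in> players"
  shows "(\<Sum>j\<in>players. value_of i (ov j)) = 1"
proof -
  have "(\<Sum>j\<in>players. value_of i (ov j)) = (\<Sum>\<beta><NB. \<Sum>j\<in>players. \<Sum>s<W. weight i \<beta> s * ov j \<beta> s)"
    unfolding value_of_def by (rule sum.swap)
  also have "\<dots> = (\<Sum>\<beta><NB. \<Sum>s<W. \<Sum>j\<in>players. weight i \<beta> s * ov j \<beta> s)"
    by (intro sum.cong refl sum.swap)
  also have "\<dots> = value_of i (\<lambda>_ _. 1)"
    unfolding value_of_def by (intro sum.cong refl) (simp add: sum_distrib_left[symmetric] ov_total)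
  finally show ?thesis using total_weight[OF assms] by simp
qed

text \<open>If the own piece were worth 0, envy-freeness would make every piece worth 0, yet all
  pieces together are worth 1. This will exclude owners who value nothing between two given
  slots.\<close>

lemma value_pos:
  assumes "i \<in> players"
  shows "0 < value_of i (ov i)"
proof (rule ccontr)
  assume "\<not> 0 < value_of i (ov i)"
  then have "value_of i (ov j) \<le> 0" if "j \<in> players" for j
    using envy_free[OF assms that] by linarith
  then have "(\<Sum>j\<in>players. value_of i (ov j)) \<le> 0" by (rule sum_nonpos)
  then show False using sum_value[OF assms] by simp
qed

section \<open>Fillers, and the confinement of everybody else to one block\<close>

lemma value_Fil_all: "value_of (Fil m) f = value_of (Fil 0) f"
  by (simp add: value_Fil)

text \<open>The fillers share one valuation and none of them envies \<open>j\<close>, so each holds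
  at least the value of the piece of \<open>j\<close>.\<close>

lemma value_Fil_le:
  assumes "j \<in> players"
  shows "real NB * value_of (Fil 0) (ov j) \<le> (\<Sum>m<NB. value_of (Fil m) (ov (Fil m)))"
proof -
  have "(\<Sum>m<NB. value_of (Fil 0) (ov j)) \<le> (\<Sum>m<NB. value_of (Fil m) (ov (Fil m)))"
    using assms envy_free by (intro sum_mono) (metis in_players(4) lessThan_iff value_Fil_all)
  then show ?thesis by simp
qed

lemma sum_Fil_le: "(\<Sum>m<NB. value_of (Fil m) (ov (Fil m))) \<le> 1"
proof -
  have "(\<Sum>m<NB. value_of (Fil m) (ov (Fil m))) = (\<Sum>i\<in>Fil ` {..<NB}. value_of (Fil 0) (ov i))"
    by (subst sum.reindex) (auto simp: inj_on_def value_Fil)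
  also have "\<dots> \<le> (\<Sum>i\<in>players. value_of (Fil 0) (ov i))"
    using value_nonneg by (intro sum_mono2) auto
  finally show ?thesis using sum_value[of "Fil 0"] NB_pos by simp
qed

lemma heads_le_1:
  assumes "j \<in> players"
  shows "(\<Sum>\<beta><NB. ov j \<beta> 0) \<le> 1"
  using value_Fil_le[OF assms] sum_Fil_le NB_pos by (simp add: value_Fil)

definition filler :: "player \<Rightarrow> bool" where "filler i \<longleftrightarrow> i \<in> range Fil"

lemma filler_simps [simp]: "\<not> filler (Big j)" "\<not> filler (Gad g q)" "\<not> filler (Con m)" "filler (Fil m)"
  by (auto simp: filler_def)

text \<open>The share of a non-filler comes on top of the shares of \<open>NB\<close> fillers, each
  at least as large. So a filler values it at no more than \<open>1 / (NB + 1)\<close>, whereas a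
  whole head is worth \<open>1 / NB\<close>.\<close>

lemma head_less_1:
  assumes "j \<in> players" "\<not> filler j" "\<beta> < NB"
  shows "ov j \<beta> 0 < 1"
proof -
  let ?v = "value_of (Fil 0) (ov j)"
  have "(\<Sum>m<NB. value_of (Fil m) (ov (Fil m))) + ?v
      = (\<Sum>i\<in>insert j (Fil ` {..<NB}). value_of (Fil 0) (ov i))"
    using assms by (subst sum.insert) (auto simp: filler_def sum.reindex inj_on_def value_Fil)
  also have "\<dots> \<le> (\<Sum>i\<in>players. value_of (Fil 0) (ov i))"
    using value_nonneg assms by (intro sum_mono2) auto
  finally have "real NB * ?v + ?v \<le> 1"
    using sum_value[of "Fil 0"] NB_pos value_Fil_le[OF assms(1)] by simp
  then have "(\<Sum>\<beta><NB. ov j \<beta> 0) + ?v \<le> 1" using NB_pos by (simp add: value_Fil)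
  moreover have "ov j \<beta> 0 \<le> (\<Sum>\<beta><NB. ov j \<beta> 0)"
    using assms ov_nonneg by (intro member_le_sum) auto
  moreover have "0 < ?v" if "0 < (\<Sum>\<beta><NB. ov j \<beta> 0)"
    using that NB_pos by (simp add: value_Fil)
  ultimately show ?thesis by linarith
qed

text \<open>On its way from an earlier block to a non-head cell of \<open>\<beta>2\<close> the piece
  would swallow the head of \<open>\<beta>2\<close>, against \<open>head_less_1\<close>.\<close>

lemma one_block:
  assumes "j \<in> players" "\<not> filler j" "0 < ov j \<beta>1 s1" "s1 < W" "0 < ov j \<beta>2 s2" "s2 < W" "0 < s2"
    "\<beta>1 < \<beta>2" "\<beta>2 < NB"
  shows False
proof -
  have "ov j \<beta>2 0 = 1"
    by (rule ov_between[OF assms(1,3,5)]) (use assms in \<open>auto simp: slot_before_def\<close>)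
  then show False using head_less_1[OF assms(1,2,9)] by simp
qed

lemma ov_zero_iff: "ov i \<beta> s = 0 \<longleftrightarrow> \<not> 0 < ov i \<beta> s"
  using ov_nonneg[of i \<beta> s] by linarith

text \<open>The case left out by the last assumption is the head of a later block, which the piece
  may enter without containing it.\<close>

lemma other_blocks_0:
  assumes "j \<in> players" "\<not> filler j" "0 < ov j \<beta>1 s1" "s1 < W" "0 < s1" "s2 < W" "\<beta>2 \<noteq> \<beta>1"
    "\<beta>1 < NB" "\<beta>2 < NB" "0 < s2 \<or> \<beta>2 < \<beta>1"
  shows "ov j \<beta>2 s2 = 0"
proof (rule ccontr)
  assume "ov j \<beta>2 s2 \<noteq> 0"
  then have "0 < ov j \<beta>2 s2" by (simp add: ov_zero_iff)
  with one_block[OF assms(1,2), of \<beta>1 s1 \<beta>2 s2] one_block[OF assms(1,2), of \<beta>2 s2 \<beta>1 s1] assms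
  show False by (cases "\<beta>1 < \<beta>2") auto
qed

section \<open>What a single piece is worth to a gadget player\<close>

definition gad_mass :: "nat \<Rightarrow> player \<Rightarrow> real" where
  "gad_mass g j = (\<Sum>i<Suc b. ov j (ZB g) (Suc (2 * i)))"

text \<open>A non-filler that meets a valued non-head cell meets valued cells of no other block; the
  plain heads are excluded because they come earlier. Otherwise only plain heads count, and
  \<open>heads_le_1\<close> limits them to the value of one head.\<close>

lemma gad_value_cases:
  assumes j: "j \<in> players" "\<not> filler j" and g: "g < K"
  obtains (zone) "value_of (Gad g q) (ov j) = x * gad_mass g j"
  | (region) r where "r < b" "value_of (Gad g q) (ov j) = x * ov j (RB r) (Suc (Suc (2 * g)))"
  | (rest) "value_of (Gad g q) (ov j) \<le> y"
proof -
  note val = value_Gad[OF g, of q "ov j", folded gad_mass_def]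
  have rW: "Suc (Suc (2 * g)) < W" using g by (simp add: W_def)
  consider (Z) i where "i < Suc b" "0 < ov j (ZB g) (Suc (2 * i))"
    | (R) r where "r < b" "0 < ov j (RB r) (Suc (Suc (2 * g)))"
    | (N) "\<forall>i<Suc b. ov j (ZB g) (Suc (2 * i)) = 0" "\<forall>r<b. ov j (RB r) (Suc (Suc (2 * g))) = 0"
    by (auto simp: ov_zero_iff)
  then show thesis
  proof cases
    case Z
    note 0 = other_blocks_0[OF j Z(2)]
    have "(\<Sum>r<b. ov j (RB r) (Suc (Suc (2 * g)))) = 0"
      using Z g rW by (intro sum.neutral ballI 0) (auto simp: block_defs W_def)
    moreover have "(\<Sum>\<beta><L. ov j \<beta> 0) = 0"
      using Z g rW by (intro sum.neutral ballI 0) (auto simp: block_defs W_def)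
    ultimately show thesis using val zone by simp
  next
    case R
    note 0 = other_blocks_0[OF j R(2)]
    have "gad_mass g j = 0"
      unfolding gad_mass_def using R g rW by (intro sum.neutral ballI 0) (auto simp: block_defs W_def)
    moreover have "(\<Sum>\<beta><L. ov j \<beta> 0) = 0"
      using R g rW by (intro sum.neutral ballI 0) (auto simp: block_defs W_def)
    moreover have "(\<Sum>r'<b. ov j (RB r') (Suc (Suc (2 * g)))) = ov j (RB r) (Suc (Suc (2 * g)))"
    proof (subst sum.remove[of _ r])
      have "(\<Sum>r'\<in>{..<b} - {r}. ov j (RB r') (Suc (Suc (2 * g)))) = 0"
        using R g rW by (intro sum.neutral ballI 0) (auto simp: block_defs W_def)
      then show "ov j (RB r) (Suc (Suc (2 * g))) + (\<Sum>r'\<in>{..<b} - {r}. ov j (RB r') (Suc (Suc (2 * g))))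
          = ov j (RB r) (Suc (Suc (2 * g)))" by simp
    qed (use R in auto)
    ultimately show thesis using val region R by simp
  next
    case N
    have "(\<Sum>\<beta><L. ov j \<beta> 0) \<le> (\<Sum>\<beta><NB. ov j \<beta> 0)"
      using ov_nonneg by (intro sum_mono2) (auto simp: NB_def)
    also have "\<dots> \<le> 1" by (rule heads_le_1[OF j(1)])
    finally have "y * (\<Sum>\<beta><L. ov j \<beta> 0) \<le> y" using y_nonneg by (simp add: mult_left_le)
    moreover have "gad_mass g j = 0" unfolding gad_mass_def using N by (intro sum.neutral) auto
    moreover have "(\<Sum>r<b. ov j (RB r) (Suc (Suc (2 * g)))) = 0" using N by (intro sum.neutral) auto
    ultimately show thesis using val rest by simp
  qed
qed

lemma value_Gad_all: "value_of (Gad g q) f = value_of (Gad g 0) f"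
  by (simp add: value_of_def)

lemma value_Con_all: "value_of (Con m) f = value_of (Con 0) f"
  by (simp add: value_of_def)

lemma sum_ov_le:
  assumes "A \<subseteq> players" "\<beta> < NB" "s < W"
  shows "(\<Sum>i\<in>A. ov i \<beta> s) \<le> 1"
  using sum_mono2[OF finite_players assms(1), of "\<lambda>i. ov i \<beta> s"] ov_nonneg ov_total[OF assms(2,3)] by simp

lemma gad_mass_total_le:
  assumes "A \<subseteq> players" "g < K"
  shows "(\<Sum>i\<in>A. gad_mass g i) \<le> real (Suc b)"
proof -
  have "(\<Sum>i\<in>A. gad_mass g i) = (\<Sum>k<Suc b. \<Sum>i\<in>A. ov i (ZB g) (Suc (2 * k)))"
    unfolding gad_mass_def by (rule sum.swap)
  also have "\<dots> \<le> (\<Sum>k<Suc b. 1)"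
    using assms by (intro sum_mono sum_ov_le) (auto simp: block_defs W_def)
  finally show ?thesis by simp
qed

text \<open>If one of the \<open>b + 1\<close> players \<open>Gad g q\<close> got more than
  \<open>x\<close>, all would, since they share a valuation. A region cell gives at most
  \<open>x\<close> and the heads at most \<open>y\<close>, so each would need more than one slot of
  mass in zone \<open>g\<close>, which has only \<open>b + 1\<close> slots.\<close>

lemma Gad_le_x:
  assumes "g < K" "q < Suc b"
  shows "value_of (Gad g q) (ov (Gad g q)) \<le> x"
proof (rule ccontr)
  assume neg: "\<not> value_of (Gad g q) (ov (Gad g q)) \<le> x"
  have big: "x < value_of (Gad g q') (ov (Gad g q'))" if "q' < Suc b" for q'
    using neg envy_free[of "Gad g q'" "Gad g q"] assms that value_Gad_all[of g q] value_Gad_all[of g q']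
    by simp
  have "1 < gad_mass g (Gad g q')" if q': "q' < Suc b" for q'
  proof (rule gad_value_cases[of "Gad g q'" g q'])
    show "1 < gad_mass g (Gad g q')"
      if "value_of (Gad g q') (ov (Gad g q')) = x * gad_mass g (Gad g q')"
      using that big[OF q'] x_pos by (simp add: mult_less_cancel_left1)
    show "1 < gad_mass g (Gad g q')" if "r < b"
      "value_of (Gad g q') (ov (Gad g q')) = x * ov (Gad g q') (RB r) (Suc (Suc (2 * g)))" for r
    proof -
      have "ov (Gad g q') (RB r) (Suc (Suc (2 * g))) \<le> 1"
        using assms q' that by (intro ov_le_1) (auto simp: block_defs W_def)
      then show ?thesis using that big[OF q'] x_pos by (simp add: mult_less_cancel_left1)
    qed
    show "1 < gad_mass g (Gad g q')" if "value_of (Gad g q') (ov (Gad g q')) \<le> y"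
      using that big[OF q'] y_less by simp
  qed (use assms q' in auto)
  then have "(\<Sum>q<Suc b. 1) < (\<Sum>q<Suc b. gad_mass g (Gad g q))"
    by (intro sum_strict_mono) auto
  moreover have "(\<Sum>q<Suc b. gad_mass g (Gad g q)) = (\<Sum>i\<in>Gad g ` {..<Suc b}. gad_mass g i)"
    by (subst sum.reindex) (auto simp: inj_on_def)
  moreover have "\<dots> \<le> real (Suc b)" using assms by (intro gad_mass_total_le) auto
  ultimately show False by simp
qed

section \<open>What a single piece is worth to a controller\<close>

definition zone_mass :: "player \<Rightarrow> real" where
  "zone_mass j = x * (\<Sum>g<K. gad_mass g j) + \<delta> * (\<Sum>g<K. \<Sum>i<b. ov j (ZB g) (Suc (Suc (2 * i))))"

lemma zone_mass_nonneg: "0 \<le> zone_mass j"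
  unfolding zone_mass_def gad_mass_def using x_pos \<delta>_pos ov_nonneg
  by (intro add_nonneg_nonneg mult_nonneg_nonneg sum_nonneg) auto

lemma value_Con_ov:
  "value_of (Con m) (ov j) = zone_mass j + x * (\<Sum>m<K * Suc b. ov j (CB m) 1)"
  by (simp add: value_Con zone_mass_def gad_mass_def del: sum.lessThan_Suc)

lemma zone_mass_total: "(\<Sum>j\<in>players. zone_mass j) = (real (K * Suc b) + 1) * x"
proof -
  have "(\<Sum>j\<in>players. gad_mass g j) = real (Suc b)" if "g < K" for g
  proof -
    have "(\<Sum>j\<in>players. gad_mass g j) = (\<Sum>k<Suc b. \<Sum>j\<in>players. ov j (ZB g) (Suc (2 * k)))"
      unfolding gad_mass_def by (rule sum.swap)
    also have "\<dots> = (\<Sum>k<Suc b. 1)"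
      using that by (intro sum.cong refl ov_total) (auto simp: block_defs W_def)
    finally show ?thesis by simp
  qed
  then have 1: "(\<Sum>j\<in>players. \<Sum>g<K. gad_mass g j) = real (K * Suc b)"
    by (subst sum.swap) (simp add: algebra_simps)
  have "(\<Sum>j\<in>players. \<Sum>i<b. ov j (ZB g) (Suc (Suc (2 * i)))) = real b" if "g < K" for g
  proof -
    have "(\<Sum>j\<in>players. \<Sum>i<b. ov j (ZB g) (Suc (Suc (2 * i))))
        = (\<Sum>i<b. \<Sum>j\<in>players. ov j (ZB g) (Suc (Suc (2 * i))))" by (rule sum.swap)
    also have "\<dots> = (\<Sum>k<b. 1)"
      using that by (intro sum.cong refl ov_total) (auto simp: block_defs W_def)
    finally show ?thesis by simp
  qed
  then have 2: "(\<Sum>j\<in>players. \<Sum>g<K. \<Sum>i<b. ov j (ZB g) (Suc (Suc (2 * i)))) = real K * real b"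
    by (subst sum.swap) simp
  have "(\<Sum>j\<in>players. zone_mass j) = x * (\<Sum>j\<in>players. \<Sum>g<K. gad_mass g j)
      + \<delta> * (\<Sum>j\<in>players. \<Sum>g<K. \<Sum>i<b. ov j (ZB g) (Suc (Suc (2 * i))))"
    unfolding zone_mass_def sum.distrib sum_distrib_left ..
  also have "\<dots> = x * real (K * Suc b) + real K * real b * \<delta>" by (simp only: 1 2) (simp add: mult_ac)
  finally show ?thesis unfolding \<delta>_total by (simp add: algebra_simps)
qed

text \<open>The cells \<open>CB m\<close> lie in separate blocks outside the zones. A non-filler
  that meets one of them holds nothing else that controllers value; any other non-filler has only
  zone cells to offer them.\<close>

lemma Con_cases:
  assumes "j \<in> players" "\<not> filler j"
  shows "value_of (Con m) (ov j) = zone_mass j \<or> value_of (Con m) (ov j) \<le> x"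
proof (cases "\<exists>m'<K * Suc b. 0 < ov j (CB m') 1")
  case False
  then have "(\<Sum>m<K * Suc b. ov j (CB m) 1) = 0" by (intro sum.neutral) (auto simp: ov_zero_iff)
  then show ?thesis by (simp add: value_Con_ov)
next
  case True
  then obtain m' where m': "m' < K * Suc b" "0 < ov j (CB m') 1" by blast
  note 0 = other_blocks_0[OF assms m'(2)]
  have C: "CB m' < NB" using m' by (simp add: block_defs)
  have "gad_mass g j = 0" if "g < K" for g
    unfolding gad_mass_def using that C
    by (intro sum.neutral ballI 0) (auto simp: block_defs W_def)
  moreover have "ov j (ZB g) (Suc (Suc (2 * i))) = 0" if "g < K" "i < b" for g i
    using that C by (intro 0) (auto simp: block_defs W_def)
  ultimately have "zone_mass j = 0" by (simp add: zone_mass_def)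
  moreover have "(\<Sum>m<K * Suc b. ov j (CB m) 1) = ov j (CB m') 1"
  proof (subst sum.remove[of _ m'])
    have "(\<Sum>m\<in>{..<K * Suc b} - {m'}. ov j (CB m) 1) = 0"
      using C by (intro sum.neutral ballI 0) (auto simp: block_defs W_def)
    then show "ov j (CB m') 1 + (\<Sum>m\<in>{..<K * Suc b} - {m'}. ov j (CB m) 1) = ov j (CB m') 1" by simp
  qed (use m' in auto)
  moreover have "ov j (CB m') 1 \<le> 1" using assms C by (intro ov_le_1) (auto simp: W_def)
  ultimately show ?thesis using x_pos by (simp add: value_Con_ov)
qed

text \<open>If one controller gets at most \<open>x\<close>, so do all of them, by their common
  valuation. Otherwise all of them live off the zones, and \<open>zone_mass_total\<close> bounds
  their sum.\<close>

lemma sum_Con_le: "(\<Sum>m<K * Suc b. value_of (Con m) (ov (Con m))) \<le> (real (K * Suc b) + 1) * x"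
proof (cases "\<exists>m<K * Suc b. value_of (Con m) (ov (Con m)) \<le> x")
  case True
  then obtain m where m: "m < K * Suc b" "value_of (Con m) (ov (Con m)) \<le> x" by blast
  have "value_of (Con m') (ov (Con m')) \<le> x" if "m' < K * Suc b" for m'
    using envy_free[of "Con m" "Con m'"] m that value_Con_all[of m] value_Con_all[of m'] by simp
  then have "(\<Sum>m<K * Suc b. value_of (Con m) (ov (Con m))) \<le> (\<Sum>m<K * Suc b. x)"
    by (intro sum_mono) auto
  then show ?thesis using x_pos by (simp add: algebra_simps)
next
  case False
  then have "value_of (Con m) (ov (Con m)) = zone_mass (Con m)" if "m < K * Suc b" for m
    using Con_cases[of "Con m" m] that by auto
  then have "(\<Sum>m<K * Suc b. value_of (Con m) (ov (Con m))) = (\<Sum>i\<in>Con ` {..<K * Suc b}. zone_mass i)"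
    by (subst sum.reindex) (auto simp: inj_on_def)
  also have "\<dots> \<le> (\<Sum>i\<in>players. zone_mass i)"
    using zone_mass_nonneg by (intro sum_mono2) auto
  finally show ?thesis by (simp add: zone_mass_total)
qed

text \<open>Slot mass 1 already accounts for the value \<open>x\<close>, so the piece meets no crumb
  of zone \<open>g\<close>. As a crumb lies between any two slots, the piece meets a single slot and
  must contain it.\<close>

lemma exact_slot:
  assumes j: "j \<in> players" and g: "g < K" and m: "1 \<le> gad_mass g j"
    and le: "value_of (Con 0) (ov j) \<le> x"
  obtains i where "i < Suc b" "ov j (ZB g) (Suc (2 * i)) = 1"
proof -
  let ?c = "\<Sum>i<b. ov j (ZB g) (Suc (Suc (2 * i)))"
  have "gad_mass g j \<le> (\<Sum>g<K. gad_mass g j)"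
    using g ov_nonneg by (intro member_le_sum) (auto simp: gad_mass_def intro!: sum_nonneg simp del: sum.lessThan_Suc)
  moreover have "?c \<le> (\<Sum>g<K. \<Sum>i<b. ov j (ZB g) (Suc (Suc (2 * i))))"
    using g ov_nonneg by (intro member_le_sum[of g "{..<K}" "\<lambda>g. \<Sum>i<b. ov j (ZB g) (Suc (Suc (2 * i)))"])
      (auto intro!: sum_nonneg)
  ultimately have "x * gad_mass g j + \<delta> * ?c \<le> zone_mass j"
    unfolding zone_mass_def using x_pos \<delta>_pos by (intro add_mono mult_left_mono) auto
  also have "\<dots> \<le> value_of (Con 0) (ov j)"
    using ov_nonneg x_pos by (simp add: value_Con_ov sum_nonneg)
  finally have *: "x * gad_mass g j + \<delta> * ?c \<le> x" using le by simp
  have c0: "0 \<le> ?c" using ov_nonneg by (intro sum_nonneg) auto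
  have "x * 1 \<le> x * gad_mass g j" using m x_pos by (intro mult_left_mono) auto
  then have "\<delta> * ?c \<le> 0" using * by simp
  then have "?c = 0" using c0 \<delta>_pos by (simp add: mult_le_0_iff)
  then have crumb: "ov j (ZB g) (Suc (Suc (2 * i))) = 0" if "i < b" for i
    using that ov_nonneg by (subst (asm) sum_nonneg_eq_0_iff) auto
  obtain i where i: "i < Suc b" "0 < ov j (ZB g) (Suc (2 * i))"
  proof (rule ccontr)
    assume "\<not> thesis"
    then have "gad_mass g j = 0"
      unfolding gad_mass_def using that by (intro sum.neutral) (auto simp: ov_zero_iff)
    then show False using m by simp
  qed
  have "ov j (ZB g) (Suc (2 * i')) = 0" if i': "i' < Suc b" "i' \<noteq> i" for i'
  proof (rule ccontr)
    assume "ov j (ZB g) (Suc (2 * i')) \<noteq> 0"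
    then have pos: "0 < ov j (ZB g) (Suc (2 * i'))" by (simp add: ov_zero_iff)
    have "ov j (ZB g) (Suc (Suc (2 * min i i'))) = 1"
    proof (rule ov_between[OF j])
      show "0 < ov j (ZB g) (Suc (2 * min i i'))" "0 < ov j (ZB g) (Suc (2 * max i i'))"
        using i pos by (auto simp: min_def max_def)
    qed (use i i' in \<open>auto simp: slot_before_def W_def min_def max_def\<close>)
    moreover have "min i i' < b" using i i' by auto
    ultimately show False using crumb by simp
  qed
  then have "gad_mass g j = ov j (ZB g) (Suc (2 * i))"
    unfolding gad_mass_def using i by (subst sum.remove[of _ i]) (auto intro!: sum.neutral)
  moreover have "ov j (ZB g) (Suc (2 * i)) \<le> 1"
    using i g j by (intro ov_le_1) (auto simp: block_defs W_def)
  ultimately show thesis using m i that by force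
qed

section \<open>Two whole slots of one zone in different hands\<close>

lemma sum_ov_subset:
  assumes "finite S" "\<And>i. i \<in> S \<Longrightarrow> t i < W" "\<beta> < NB"
  shows "(\<Sum>j\<in>players. \<Sum>i\<in>S. ov j \<beta> (t i)) = real (card S)"
proof -
  have "(\<Sum>j\<in>players. \<Sum>i\<in>S. ov j \<beta> (t i)) = (\<Sum>i\<in>S. \<Sum>j\<in>players. ov j \<beta> (t i))"
    by (rule sum.swap)
  also have "\<dots> = (\<Sum>i\<in>S. 1)" using assms by (intro sum.cong refl ov_total) auto
  finally show ?thesis by simp
qed

text \<open>To a controller, every piece lying between the two held slots is worth exactly \<open>x\<close>, but everything
  between these slots together is not worth a multiple of \<open>x\<close>.\<close>

lemma no_two_exact_slots:
  assumes g: "g < K" and j12: "j1 \<in> players" "j2 \<in> players"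
    and i12: "i1 < i2" "i2 < Suc b"
    and ov1: "ov j1 (ZB g) (Suc (2 * i1)) = 1" and ov2: "ov j2 (ZB g) (Suc (2 * i2)) = 1"
    and le: "\<And>j. j \<in> players \<Longrightarrow> value_of (Con 0) (ov j) \<le> x"
    and con: "\<And>m. m < K * Suc b \<Longrightarrow> x \<le> value_of (Con m) (ov (Con m))"
    and gad: "\<And>q. q < Suc b \<Longrightarrow> x \<le> value_of (Gad g q) (ov (Gad g q))"
  shows False
proof -
  define A where "A j = (\<Sum>i\<in>{i1<..<i2}. ov j (ZB g) (Suc (2 * i)))" for j
  define C where "C j = (\<Sum>i\<in>{i1..<i2}. ov j (ZB g) (Suc (Suc (2 * i))))" for j
  \<comment> \<open>To a controller, \<open>D j\<close> is the value of the part of \<open>j\<close>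
    in the gap between the two held slots: \<open>A\<close> collects the slots strictly inside,
    \<open>C\<close> the crumbs.\<close>
  define D where "D j = x * A j + \<delta> * C j" for j
  have AC0: "0 \<le> A j" "0 \<le> C j" for j
    using ov_nonneg by (auto simp: A_def C_def intro!: sum_nonneg)
  have ZNB: "ZB g < NB" using g by (simp add: block_defs)
  \<comment> \<open>The held slot alone exhausts the bound \<open>x\<close> on what the piece is
    worth to a controller.\<close>
  have end_slot: "D j = 0" if j: "j \<in> players" and i: "i < Suc b" "i \<notin> {i1<..<i2}"
    and one: "ov j (ZB g) (Suc (2 * i)) = 1" for j i
  proof -
    have "1 + A j = (\<Sum>i\<in>insert i {i1<..<i2}. ov j (ZB g) (Suc (2 * i)))"
      using i one by (simp add: A_def)
    also have "\<dots> \<le> gad_mass g j"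
      unfolding gad_mass_def using i i12 ov_nonneg by (intro sum_mono2) auto
    also have "\<dots> \<le> (\<Sum>g<K. gad_mass g j)"
      using g ov_nonneg
      by (intro member_le_sum) (auto simp: gad_mass_def intro!: sum_nonneg simp del: sum.lessThan_Suc)
    finally have 1: "1 + A j \<le> (\<Sum>g<K. gad_mass g j)" .
    have "C j \<le> (\<Sum>i<b. ov j (ZB g) (Suc (Suc (2 * i))))"
      unfolding C_def using i12 ov_nonneg by (intro sum_mono2) auto
    also have "\<dots> \<le> (\<Sum>g<K. \<Sum>i<b. ov j (ZB g) (Suc (Suc (2 * i))))"
      using g ov_nonneg by (intro member_le_sum[of g "{..<K}" "\<lambda>g. \<Sum>i<b. ov j (ZB g) (Suc (Suc (2 * i)))"])
        (auto intro!: sum_nonneg)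
    finally have "x * (1 + A j) + \<delta> * C j \<le> zone_mass j"
      unfolding zone_mass_def using x_pos \<delta>_pos 1 by (intro add_mono mult_left_mono) auto
    also have "\<dots> \<le> value_of (Con 0) (ov j)"
      using ov_nonneg x_pos by (simp add: value_Con_ov sum_nonneg)
    also have "\<dots> \<le> x" by (rule le[OF j])
    finally have "D j \<le> 0" by (simp add: D_def algebra_simps)
    moreover have "0 \<le> D j" unfolding D_def using AC0 x_pos \<delta>_pos by simp
    ultimately show ?thesis by simp
  qed
  have D_cases: "D j = 0 \<or> D j = x" if j: "j \<in> players" for j
  proof (cases "j = j1 \<or> j = j2")
    case True
    then show ?thesis
      using end_slot[of j1 i1] end_slot[of j2 i2] ov1 ov2 i12 j12 by auto
  next
    case False
    have e1: "ov j (ZB g) (Suc (2 * i1)) = 0"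
      by (rule ov_exclusive[OF j12(1) j _ ov1 ZNB]) (use False i12 in \<open>auto simp: W_def\<close>)
    have e2: "ov j (ZB g) (Suc (2 * i2)) = 0"
      by (rule ov_exclusive[OF j12(2) j _ ov2 ZNB]) (use False i12 in \<open>auto simp: W_def\<close>)
    show ?thesis
    proof (cases "\<exists>s. Suc (2 * i1) < s \<and> s < Suc (2 * i2) \<and> 0 < ov j (ZB g) s")
      case False
      then have "ov j (ZB g) s = 0" if "Suc (2 * i1) < s" "s < Suc (2 * i2)" for s
        using that ov_zero_iff by blast
      then have "A j = 0" "C j = 0" by (auto simp: A_def C_def intro!: sum.neutral)
      then show ?thesis by (simp add: D_def)
    next
      case True
      then obtain s where s: "Suc (2 * i1) < s" "s < Suc (2 * i2)" "0 < ov j (ZB g) s" by blast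
      have W: "Suc (2 * i2) < W" using i12 by (simp add: W_def)
      \<comment> \<open>The piece meets the gap. As an interval it can leave the gap only by
        containing an end slot, and those belong to \<open>j1\<close> and \<open>j2\<close>.\<close>
      have out: "ov j \<beta> t = 0" if t: "t < W" "\<beta> \<noteq> ZB g \<or> t \<le> Suc (2 * i1) \<or> Suc (2 * i2) \<le> t" for \<beta> t
      proof (rule ccontr)
        assume "ov j \<beta> t \<noteq> 0"
        then have pos: "0 < ov j \<beta> t" by (simp add: ov_zero_iff)
        consider "slot_before \<beta> t (ZB g) (Suc (2 * i1))" | "slot_before (ZB g) (Suc (2 * i2)) \<beta> t"
          | "\<beta> = ZB g \<and> (t = Suc (2 * i1) \<or> t = Suc (2 * i2))"
          using t by (fastforce simp: slot_before_def)
        then show False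
        proof cases
          case 1
          then have "ov j (ZB g) (Suc (2 * i1)) = 1"
            using ov_between[OF j pos s(3) 1] s t W by (simp add: slot_before_def)
          then show False using e1 by simp
        next
          case 2
          then have "ov j (ZB g) (Suc (2 * i2)) = 1"
            using ov_between[OF j s(3) pos _ 2] s t W by (simp add: slot_before_def)
          then show False using e2 by simp
        next
          case 3
          then show False using e1 e2 pos by auto
        qed
      qed
      have gm: "gad_mass g j = A j"
        unfolding gad_mass_def A_def
        using i12 by (intro sum.mono_neutral_right) (auto intro!: out simp: W_def)
      have gm0: "gad_mass g' j = 0" if "g' \<noteq> g" "g' < K" for g'
        unfolding gad_mass_def using that by (intro sum.neutral ballI out) (auto simp: W_def block_defs)
      have cr: "(\<Sum>i<b. ov j (ZB g) (Suc (Suc (2 * i)))) = C j"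
        unfolding C_def using i12 by (intro sum.mono_neutral_right) (auto intro!: out simp: W_def)
      have cr0: "(\<Sum>i<b. ov j (ZB g') (Suc (Suc (2 * i)))) = 0" if "g' \<noteq> g" "g' < K" for g'
        using that by (intro sum.neutral ballI out) (auto simp: W_def block_defs)
      have "(\<Sum>g<K. gad_mass g j) = A j"
        using g gm gm0 by (subst sum.remove[of _ g]) (auto intro!: sum.neutral)
      moreover have "(\<Sum>g<K. \<Sum>i<b. ov j (ZB g) (Suc (Suc (2 * i)))) = C j"
        using g cr cr0 by (subst sum.remove[of _ g]) (auto intro!: sum.neutral)
      moreover have "(\<Sum>m<K * Suc b. ov j (CB m) 1) = 0"
        by (intro sum.neutral ballI out) (use g in \<open>auto simp: W_def block_defs\<close>)
      ultimately have Con: "value_of (Con m) (ov j) = D j" for m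
        by (simp add: value_Con_ov zone_mass_def D_def)
      have reg: "(\<Sum>r<b. ov j (RB r) (Suc (Suc (2 * g')))) = 0" if "g' < K" for g'
        using that by (intro sum.neutral ballI out) (auto simp: W_def block_defs)
      have heads: "ov j \<beta> 0 = 0" for \<beta> by (intro out) (auto simp: W_def)
      have gadv: "value_of (Gad g' q) (ov j) = x * gad_mass g' j" if "g' < K" for g' q
        using value_Gad[OF that, of q "ov j"] reg[OF that] heads by (simp add: gad_mass_def)
      \<comment> \<open>The owner has to draw its whole value from the gap. A player
        \<open>Gad g q\<close> or a controller needs \<open>x\<close>; anybody else would be left
        with 0, against \<open>value_pos\<close>.\<close>
      have "x \<le> D j"
      proof (cases j)
        case (Big r)
        then have RZ: "RB r \<noteq> ZB g" using j by (simp add: block_defs)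
        have "value_of (Big r) (ov j) = 0"
        proof -
          have "(\<Sum>i<Suc K. ov j (RB r) (Suc (2 * i))) = 0"
            using RZ by (intro sum.neutral ballI out) (auto simp: W_def)
          then show ?thesis using j Big by (simp add: value_Big del: sum.lessThan_Suc)
        qed
        then show ?thesis using value_pos[OF j] Big by simp
      next
        case (Gad g' q)
        show ?thesis
        proof (cases "g' = g")
          case True
          then have "x \<le> x * A j" using gad[of q] gadv[of g q] gm Gad j by simp
          then show ?thesis using AC0 \<delta>_pos by (simp add: D_def add_increasing2)
        next
          case False
          then have "value_of j (ov j) = 0" using gadv[of g' q] gm0[of g'] Gad j by simp
          then show ?thesis using value_pos[OF j] by simp
        qed
      next
        case (Con m)
        then show ?thesis using con[of m] j \<open>\<And>m. value_of (Con m) (ov j) = D j\<close> by simp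
      next
        case (Fil m)
        then show ?thesis using value_pos[OF j] heads by (simp add: value_Fil)
      qed
      moreover have "D j \<le> x" using le[OF j] Con[of 0] by simp
      ultimately show ?thesis by simp
    qed
  qed
  \<comment> \<open>\<open>N\<close> pieces worth \<open>x\<close> make up a gap with
    \<open>d - 1\<close> slots and \<open>d\<close> crumbs.\<close>
  define N where "N = card {j \<in> players. D j = x}"
  define d where "d = i2 - i1"
  have d: "1 \<le> d" "d \<le> b" using i12 by (auto simp: d_def)
  have "(\<Sum>j\<in>players. D j) = (\<Sum>j\<in>players. if D j = x then x else 0)"
    using D_cases x_pos by (intro sum.cong) auto
  also have "\<dots> = x * real N" by (simp add: N_def sum.If_cases Int_def)
  finally have "x * real N = x * (\<Sum>j\<in>players. A j) + \<delta> * (\<Sum>j\<in>players. C j)"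
    by (simp add: D_def sum.distrib sum_distrib_left)
  moreover have "(\<Sum>j\<in>players. A j) = real d - 1"
    unfolding A_def using i12 ZNB d
    by (subst sum_ov_subset) (auto simp: W_def d_def)
  moreover have "(\<Sum>j\<in>players. C j) = real d"
    unfolding C_def using i12 ZNB
    by (subst sum_ov_subset) (auto simp: W_def d_def)
  ultimately have eq: "x * real N = x * (real d - 1) + \<delta> * real d" by simp
  \<comment> \<open>The crumbs have positive value, so \<open>N\<close> is at least
    \<open>d\<close>. Then \<open>d\<close> crumbs are worth at least \<open>x\<close>, the value of
    all \<open>K * b\<close> crumbs, although \<open>d\<close> is at most \<open>b\<close> and
    \<open>K\<close> is at least 2.\<close>
  then have "x * (real d - 1) < x * real N" using \<delta>_pos d by simp
  then have "real d - 1 < real N" using x_pos by simp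
  then have "real d < real (Suc N)" by simp
  then have "real d \<le> real N" by (simp only: of_nat_less_iff of_nat_le_iff less_Suc_eq_le)
  then have "x * real d \<le> x * real N" using x_pos by simp
  then have "x \<le> \<delta> * real d" using eq by (simp add: algebra_simps)
  then have "\<delta> * (real K * real b) \<le> \<delta> * real d" using \<delta>_total by (simp add: mult_ac)
  then have "K * b \<le> d" using \<delta>_pos by (metis mult_le_cancel_left_pos of_nat_le_iff of_nat_mult)
  moreover have "2 * b \<le> K * b" using K by (intro mult_le_mono1)
  ultimately show False using d by linarith
qed

section \<open>Separating cells are cut, and the welfare bound that follows\<close>

lemma region_cut:
  assumes j: "j < b" and r: "r < b" and g: "g < K"
  shows "ov (Big j) (RB r) (Suc (Suc (2 * g))) \<noteq> 1"
proof
  assume held: "ov (Big j) (RB r) (Suc (Suc (2 * g))) = 1"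
  have rNB: "RB r' < NB" if "r' < b" for r' using that by (simp add: block_defs)
  have sW: "Suc (Suc (2 * g)) < W" using g by (simp add: W_def)
  \<comment> \<open>Each \<open>Gad g q\<close> sees a cell worth \<open>x\<close> in the piece of
    \<open>Big j\<close>, and does not envy it.\<close>
  have happy: "x \<le> value_of (Gad g q) (ov (Gad g q))" if "q < Suc b" for q
  proof -
    have "1 \<le> (\<Sum>r<b. ov (Big j) (RB r) (Suc (Suc (2 * g))))"
      unfolding held[symmetric] using r ov_nonneg
      by (intro member_le_sum[of r "{..<b}" "\<lambda>r. ov (Big j) (RB r) (Suc (Suc (2 * g)))"]) auto
    then have "x * 1 \<le> x * (\<Sum>r<b. ov (Big j) (RB r) (Suc (Suc (2 * g))))"
      using x_pos by (intro mult_left_mono) auto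
    moreover have "0 \<le> x * (\<Sum>i<Suc b. ov (Big j) (ZB g) (Suc (2 * i)))" "0 \<le> y * (\<Sum>\<beta><L. ov (Big j) \<beta> 0)"
      using x_pos y_nonneg ov_nonneg by (auto intro!: mult_nonneg_nonneg sum_nonneg simp del: sum.lessThan_Suc)
    ultimately have "x \<le> value_of (Gad g q) (ov (Big j))" by (simp add: value_Gad[OF g] del: sum.lessThan_Suc)
    also have "\<dots> \<le> value_of (Gad g q) (ov (Gad g q))" using that g j by (intro envy_free) auto
    finally show ?thesis .
  qed
  have place: "1 \<le> gad_mass g (Gad g q) \<or> (\<exists>r'<b. ov (Gad g q) (RB r') (Suc (Suc (2 * g))) = 1)"
    if q: "q < Suc b" for q
  proof (rule gad_value_cases[of "Gad g q" g q])
    assume "value_of (Gad g q) (ov (Gad g q)) = x * gad_mass g (Gad g q)"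
    then show ?thesis using happy[OF q] x_pos by simp
  next
    fix r' assume r': "r' < b" and "value_of (Gad g q) (ov (Gad g q)) = x * ov (Gad g q) (RB r') (Suc (Suc (2 * g)))"
    then have "1 \<le> ov (Gad g q) (RB r') (Suc (Suc (2 * g)))" using happy[OF q] x_pos by simp
    moreover have "ov (Gad g q) (RB r') (Suc (Suc (2 * g))) \<le> 1"
      using q g r' rNB sW by (intro ov_le_1) auto
    ultimately show ?thesis using r' by force
  next
    assume "value_of (Gad g q) (ov (Gad g q)) \<le> y"
    then show ?thesis using happy[OF q] y_less by simp
  qed (use q g in auto)
  \<comment> \<open>Each player in \<open>Q\<close> holds the whole cell \<open>g\<close> of some
    region. These regions are distinct and differ from \<open>r\<close>, where \<open>Big j\<close>
    holds that cell, so \<open>Q\<close> has at most \<open>b - 1\<close> of the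
    \<open>b + 1\<close> players.\<close>
  define Q where "Q = {q. q < Suc b \<and> gad_mass g (Gad g q) < 1}"
  have "\<forall>q\<in>Q. \<exists>r'<b. ov (Gad g q) (RB r') (Suc (Suc (2 * g))) = 1"
    using place by (force simp: Q_def)
  then obtain f where f: "\<And>q. q \<in> Q \<Longrightarrow> f q < b"
    "\<And>q. q \<in> Q \<Longrightarrow> ov (Gad g q) (RB (f q)) (Suc (Suc (2 * g))) = 1" by metis
  have "inj_on f Q"
  proof (rule inj_onI, rule ccontr)
    fix q q' assume q: "q \<in> Q" "q' \<in> Q" "f q = f q'" "q \<noteq> q'"
    then have "ov (Gad g q') (RB (f q)) (Suc (Suc (2 * g))) = 0"
      using g f(1)[OF q(1)] f(2)[OF q(1)] rNB sW q(1,2,4)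
      by (intro ov_exclusive[of "Gad g q" "Gad g q'"]) (auto simp: Q_def)
    then show False using q f(2)[of q'] by simp
  qed
  moreover have "f ` Q \<subseteq> {..<b} - {r}"
  proof (rule image_subsetI)
    fix q assume q: "q \<in> Q"
    show "f q \<in> {..<b} - {r}"
    proof -
      have "f q \<noteq> r"
      proof
        assume "f q = r"
        then have "ov (Gad g q) (RB r) (Suc (Suc (2 * g))) = 0"
          using g f rNB sW held q j r by (intro ov_exclusive[of "Big j" "Gad g q"]) (auto simp: Q_def)
        then show False using f(2)[OF q] \<open>f q = r\<close> by simp
      qed
      then show ?thesis using f(1)[OF q] by simp
    qed
  qed
  ultimately have "card Q \<le> card ({..<b} - {r})" by (intro card_inj_on_le[of f]) auto
  then have "card Q \<le> b - 1" using r by simp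
  moreover have "card ({..<Suc b} - Q) = Suc b - card Q"
    by (subst card_Diff_subset) (auto simp: Q_def)
  ultimately have "2 \<le> card ({..<Suc b} - Q)" using b by simp
  then obtain q1 q2 where q12: "q1 \<in> {..<Suc b} - Q" "q2 \<in> {..<Suc b} - Q" "q1 \<noteq> q2"
    by (metis card_le_Suc0_iff_eq finite_Diff finite_lessThan not_less_eq_eq numeral_2_eq_2)
  then have q: "q1 < Suc b" "q2 < Suc b" "1 \<le> gad_mass g (Gad g q1)" "1 \<le> gad_mass g (Gad g q2)"
    by (auto simp: Q_def)
  have "x \<le> zone_mass (Gad g q1)"
  proof -
    have "gad_mass g (Gad g q1) \<le> (\<Sum>g'<K. gad_mass g' (Gad g q1))"
      using g ov_nonneg
      by (intro member_le_sum) (auto simp: gad_mass_def intro!: sum_nonneg simp del: sum.lessThan_Suc)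
    then have "x * 1 \<le> x * (\<Sum>g'<K. gad_mass g' (Gad g q1))"
      using q x_pos by (intro mult_left_mono) auto
    moreover have "0 \<le> \<delta> * (\<Sum>g'<K. \<Sum>i<b. ov (Gad g q1) (ZB g') (Suc (Suc (2 * i))))"
      using \<delta>_pos ov_nonneg by (intro mult_nonneg_nonneg sum_nonneg) auto
    ultimately show ?thesis by (simp add: zone_mass_def)
  qed
  moreover have "zone_mass (Gad g q1) \<le> value_of (Con m) (ov (Gad g q1))" for m
    using ov_nonneg x_pos by (simp add: value_Con_ov sum_nonneg)
  ultimately have con: "x \<le> value_of (Con m) (ov (Con m))" if "m < K * Suc b" for m
    using envy_free[of "Con m" "Gad g q1"] that g q by (meson in_players order_trans)
  \<comment> \<open>Controllers that all get more than \<open>x\<close> would take it from the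
    zones. With the \<open>x\<close> that \<open>Gad g q1\<close> takes there, this exceeds
    \<open>zone_mass_total\<close>.\<close>
  have "\<exists>m<K * Suc b. value_of (Con m) (ov (Con m)) \<le> x"
  proof (rule ccontr)
    assume "\<not> ?thesis"
    then have "x < zone_mass (Con m)" if "m < K * Suc b" for m
      using Con_cases[of "Con m" m] that by force
    then have "(\<Sum>m<K * Suc b. x) < (\<Sum>m<K * Suc b. zone_mass (Con m))"
      using K by (intro sum_strict_mono) (auto simp: lessThan_empty_iff)
    then have "real (K * Suc b) * x + x < (\<Sum>i\<in>insert (Gad g q1) (Con ` {..<K * Suc b}). zone_mass i)"
      using \<open>x \<le> zone_mass (Gad g q1)\<close>
      by (subst sum.insert) (auto simp: sum.reindex inj_on_def)
    also have "\<dots> \<le> (\<Sum>i\<in>players. zone_mass i)"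
      using zone_mass_nonneg g q by (intro sum_mono2) auto
    finally show False by (simp add: zone_mass_total algebra_simps)
  qed
  then obtain m where m: "m < K * Suc b" "value_of (Con m) (ov (Con m)) \<le> x" by blast
  have le: "value_of (Con 0) (ov i) \<le> x" if "i \<in> players" for i
    using envy_free[of "Con m" i] that m value_Con_all[of m] by simp
  obtain i1 where i1: "i1 < Suc b" "ov (Gad g q1) (ZB g) (Suc (2 * i1)) = 1"
    by (rule exact_slot[OF _ g q(3) le]) (use g q in auto)
  obtain i2 where i2: "i2 < Suc b" "ov (Gad g q2) (ZB g) (Suc (2 * i2)) = 1"
    by (rule exact_slot[OF _ g q(4) le]) (use g q in auto)
  have "i1 \<noteq> i2"
    using ov_exclusive[of "Gad g q1" "Gad g q2" "ZB g" "Suc (2 * i1)"] i1 i2 g q q12(3)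
    by (auto simp: block_defs W_def)
  then show False
    using no_two_exact_slots[OF g _ _ _ _ i1(2) i2(2) le con happy]
      no_two_exact_slots[OF g _ _ _ _ i2(2) i1(2) le con happy] i1 i2 g q
    by (metis in_players(2) linorder_neqE_nat)
qed

text \<open>A piece meeting two slots of the region would contain a separating cell, which
  \<open>region_cut\<close> forbids. So at most one slot is met.\<close>

lemma Big_le:
  assumes j: "j < b"
  shows "value_of (Big j) (ov (Big j)) \<le> 1 / real (Suc K)"
proof -
  let ?f = "\<lambda>i. ov (Big j) (RB j) (Suc (2 * i))"
  have RNB: "RB j < NB" using j by (simp add: block_defs)
  have unique: "i = i'" if ii: "i < Suc K" "i' < Suc K" "0 < ?f i" "0 < ?f i'" for i i'
  proof (rule ccontr)
    assume "i \<noteq> i'"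
    have "ov (Big j) (RB j) (Suc (Suc (2 * min i i'))) = 1"
    proof (rule ov_between)
      show "0 < ?f (min i i')" "0 < ?f (max i i')"
        using ii by (auto simp: min_def max_def)
    qed (use j ii \<open>i \<noteq> i'\<close> in \<open>auto simp: slot_before_def W_def min_def max_def\<close>)
    moreover have "min i i' < K" using ii \<open>i \<noteq> i'\<close> by auto
    ultimately show False using region_cut[OF j j] by simp
  qed
  have "(\<Sum>i<Suc K. ?f i) \<le> 1"
  proof (cases "\<exists>i<Suc K. 0 < ?f i")
    case True
    then obtain i where i: "i < Suc K" "0 < ?f i" by blast
    then have "(\<Sum>i<Suc K. ?f i) = ?f i"
      using unique by (subst sum.remove[of _ i]) (auto intro!: sum.neutral simp: ov_zero_iff)
    moreover have "?f i \<le> 1" using i j RNB by (intro ov_le_1) (auto simp: W_def)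
    ultimately show ?thesis by simp
  next
    case False
    then have "(\<Sum>i<Suc K. ?f i) = 0" by (intro sum.neutral) (auto simp: ov_zero_iff)
    then show ?thesis by simp
  qed
  then show ?thesis using j by (simp add: value_Big divide_right_mono del: sum.lessThan_Suc of_nat_Suc)
qed

text \<open>Gadget players and controllers together get at most \<open>2 * K * Suc b + 1\<close>
  times \<open>x\<close>, which is 1, and the fillers add at most 1.\<close>

lemma welfare_le: "(\<Sum>i\<in>players. value_of i (ov i)) \<le> real b / real (Suc K) + 2"
proof -
  have "(\<Sum>j<b. value_of (Big j) (ov (Big j))) \<le> (\<Sum>j<b. 1 / real (Suc K))"
    using Big_le by (intro sum_mono) auto
  moreover have "(\<Sum>g<K. \<Sum>q<Suc b. value_of (Gad g q) (ov (Gad g q))) \<le> (\<Sum>g<K. \<Sum>q<Suc b. x)"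
    using Gad_le_x by (intro sum_mono) auto
  moreover have "(\<Sum>g<K. \<Sum>q<Suc b. x) + (real (K * Suc b) + 1) * x = 1"
    using x_total by (simp add: algebra_simps)
  ultimately show ?thesis
    unfolding sum_players using sum_Con_le sum_Fil_le by simp
qed

end


section \<open>The partial division\<close>

context dumping_cake
begin

text \<open>A piece is encoded as a block with a half-open range of positions, so that disjointness
  and envy reduce to arithmetic.\<close>

fun blk :: "player \<Rightarrow> nat" where
  "blk (Big j) = RB j"
| "blk (Gad g q) = ZB g"
| "blk (Con m) = CB m"
| "blk (Fil m) = m"

fun start :: "player \<Rightarrow> nat" where
  "start (Big j) = 1"
| "start (Gad g q) = Suc (2 * q)"
| "start (Con m) = 1"
| "start (Fil m) = 0"

text \<open>The last gadget player of a zone also takes its worthless remainder, and the filler of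
  an undumped plain block takes all of it. Thus only the intervals in \<open>dumps\<close> stay
  unallocated.\<close>

fun stop :: "player \<Rightarrow> nat" where
  "stop (Big j) = W"
| "stop (Gad g q) = (if q < b then Suc (Suc (2 * q)) else W)"
| "stop (Con m) = W"
| "stop (Fil m) = (if z \<le> m \<and> m < L then W else 1)"

definition dumps :: "(nat \<times> nat \<times> nat) set" where
  "dumps = (\<lambda>m. (m, 1, W)) ` {..<z}
     \<union> (\<lambda>(g, q). (ZB g, Suc (Suc (2 * q)), Suc (Suc (Suc (2 * q))))) ` ({..<K} \<times> {..<b})"

definition held :: "player \<Rightarrow> nat \<Rightarrow> nat \<Rightarrow> real" where
  "held i \<beta> s = (if \<beta> = blk i \<and> start i \<le> s \<and> s < stop i then 1 else 0)"

lemma blk_less: "i \<in> players \<Longrightarrow> blk i < NB"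
  by (cases i) (auto simp: block_defs)

lemma start_less_stop: "i \<in> players \<Longrightarrow> start i < stop i"
  by (cases i) (auto simp: W_def)

lemma stop_le_W: "i \<in> players \<Longrightarrow> stop i \<le> W"
  by (cases i) (auto simp: W_def)

lemma pieces_disjoint:
  assumes "i \<in> players" "j \<in> players" "i \<noteq> j" "blk i = blk j"
  shows "stop i \<le> start j \<or> stop j \<le> start i"
  using assms by (cases i; cases j) (auto simp: block_defs)

lemma dump_piece_disjoint:
  assumes "(\<beta>, u, w) \<in> dumps" "j \<in> players" "blk j = \<beta>"
  shows "stop j \<le> u \<or> w \<le> start j"
  using assms z by (cases j) (auto simp: dumps_def block_defs)

lemma dumps_disjoint:
  assumes "(\<beta>, u, w) \<in> dumps" "(\<beta>, u', w') \<in> dumps" "(u, w) \<noteq> (u', w')"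
  shows "w \<le> u' \<or> w' \<le> u"
  using assms z by (auto simp: dumps_def block_defs)

lemma dumps_bounds:
  assumes "(\<beta>, u, w) \<in> dumps"
  shows "\<beta> < NB" "u < w" "w \<le> W"
  using assms z by (auto simp: dumps_def block_defs W_def)

text \<open>Pieces count with their closures, so the left end of a dumped interval belongs to the
  piece found here; the unallocated set is therefore open on that side.\<close>

lemma dump_pred:
  assumes "(\<beta>, u, w) \<in> dumps"
  obtains i where "i \<in> players" "blk i = \<beta>" "stop i = u"
proof -
  consider "\<beta> < z" "u = 1" | g q where "\<beta> = ZB g" "u = Suc (Suc (2 * q))" "g < K" "q < b"
    using assms by (auto simp: dumps_def)
  then show thesis
  proof cases
    case 1
    then show thesis using that[of "Fil \<beta>"] z by (auto simp: block_defs)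
  next
    case 2
    then show thesis using that[of "Gad g q"] by auto
  qed
qed

lemma block_cases:
  assumes "\<beta> < NB"
  obtains (E) "\<beta> < L" | (R) j where "\<beta> = RB j" "j < b" | (Z) g where "\<beta> = ZB g" "g < K"
    | (C) m where "\<beta> = CB m" "m < K * Suc b"
proof -
  have "\<beta> < L \<or> \<beta> = RB (\<beta> - L) \<and> \<beta> - L < b \<or> \<beta> = ZB (\<beta> - L - b) \<and> \<beta> - L - b < K
     \<or> \<beta> = CB (\<beta> - L - b - K) \<and> \<beta> - L - b - K < K * Suc b"
    using assms unfolding block_defs by linarith
  then show thesis using that by metis
qed

lemma cell_cases:
  assumes "\<beta> < NB" "s < W"
  obtains (piece) i where "i \<in> players" "blk i = \<beta>" "start i \<le> s" "s < stop i"
    | (dump) u w where "(\<beta>, u, w) \<in> dumps" "u \<le> s" "s < w"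
proof (cases "s = 0")
  case True
  then show thesis using assms piece[of "Fil \<beta>"] by (auto simp: W_def)
next
  case s: False
  from assms(1) show thesis
  proof (cases rule: block_cases)
    case E
    then show thesis
      using assms s piece[of "Fil \<beta>"] dump[of 1 W] by (cases "z \<le> \<beta>") (auto simp: dumps_def)
  next
    case (R j)
    then show thesis using assms s piece[of "Big j"] by auto
  next
    case (Z g)
    show thesis
    proof (cases "2 * b < s")
      case True
      then show thesis using assms Z piece[of "Gad g b"] by auto
    next
      case False
      show thesis
      proof (cases "odd s")
        case True
        then obtain q where "s = Suc (2 * q)" by (elim oddE) simp
        then show thesis using False Z piece[of "Gad g q"] by auto
      next
        case even: False
        then obtain q' where "s = 2 * q'" by blast
        with s obtain q where "s = Suc (Suc (2 * q))" by (cases q') auto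
        then show thesis using False Z dump[of s "Suc s"] by (force simp: dumps_def)
      qed
    qed
  next
    case (C m)
    then show thesis using assms s piece[of "Con m"] by auto
  qed
qed

lemma held_simps:
  "j < b \<Longrightarrow> held (Big j) (ZB g) s = 0"
  "j < b \<Longrightarrow> held (Big j) (CB m) s = 0"
  "Suc s < W \<Longrightarrow> held (Big j) (RB r) (Suc s) = (if r = j then 1 else 0)"
  "i < Suc b \<Longrightarrow> q < Suc b \<Longrightarrow> held (Gad g q) (ZB g') (Suc (2 * i)) = (if i = q then if g' = g then 1 else 0 else 0)"
  "i < b \<Longrightarrow> q < Suc b \<Longrightarrow> held (Gad g q) (ZB g') (Suc (Suc (2 * i))) = 0"
  "r < b \<Longrightarrow> held (Gad g q) (RB r) s = 0"
  "g < K \<Longrightarrow> held (Gad g q) (CB m) s = 0"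
  "g < K \<Longrightarrow> held (Con m) (ZB g) s = 0"
  "r < b \<Longrightarrow> held (Con m) (RB r) s = 0"
  "held (Con m) (CB m') (Suc 0) = (if m' = m then 1 else 0)"
  "held (Fil m) (ZB g) (Suc s) = 0" "held (Fil m) (RB r) (Suc s) = 0" "held (Fil m) (CB m') (Suc s) = 0"
  "held (Big j) \<beta> 0 = 0" "held (Gad g q) \<beta> 0 = 0" "held (Con m) \<beta> 0 = 0"
  "held (Fil m) \<beta> 0 = (if \<beta> = m then 1 else 0)"
  by (auto simp: held_def block_defs W_def)

lemma slot_less_W: "i < Suc K \<Longrightarrow> Suc (2 * i) < W" "g < K \<Longrightarrow> Suc (Suc (2 * g)) < W"
  by (auto simp: W_def)

lemma held_value_own:
  "j < b \<Longrightarrow> value_of (Big j) (held (Big j)) = 1"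
  "g < K \<Longrightarrow> q < Suc b \<Longrightarrow> value_of (Gad g q) (held (Gad g q)) = x"
  "m < K * Suc b \<Longrightarrow> value_of (Con m) (held (Con m)) = x"
  "m < NB \<Longrightarrow> value_of (Fil m) (held (Fil m)) = 1 / real NB"
  by (simp_all add: value_Big value_Gad value_Con value_Fil held_simps slot_less_W del: sum.lessThan_Suc mult_Suc_right)

text \<open>A big player holds all that it values. Any other player holds one favourite cell, and no
  piece is worth more to it than one such cell.\<close>

lemma held_envy_free:
  assumes i: "i \<in> players" and j: "j \<in> players"
  shows "value_of i (held j) \<le> value_of i (held i)"
proof (cases i)
  case (Big r)
  have "value_of i (held j) \<le> value_of i (\<lambda>_ _. 1)"
    unfolding value_of_def by (intro sum_mono mult_left_mono weight_nonneg) (auto simp: held_def)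
  then show ?thesis using i Big by (simp add: total_weight held_value_own)
next
  case (Gad g q)
  then have g: "g < K" "q < Suc b" using i by auto
  have "value_of (Gad g q) (held j) \<le> x"
  proof (cases j)
    case (Fil m)
    have "(\<Sum>\<beta><L. held j \<beta> 0) \<le> 1" by (simp add: Fil held_simps)
    then have "y * (\<Sum>\<beta><L. held j \<beta> 0) \<le> y" using y_nonneg by (simp add: mult_left_le)
    then show ?thesis using g y_less Fil
      by (simp add: value_Gad held_simps del: sum.lessThan_Suc)
  qed (use g j x_pos in \<open>simp_all add: value_Gad held_simps slot_less_W del: sum.lessThan_Suc\<close>)
  then show ?thesis using g Gad by (simp add: held_value_own)
next
  case (Con m)
  have "value_of (Con m) (held j) \<le> x"
    using j x_pos
    by (cases j) (simp_all add: value_Con held_simps slot_less_W del: sum.lessThan_Suc mult_Suc_right)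
  then show ?thesis using i Con by (simp add: held_value_own)
next
  case (Fil m)
  have "value_of (Fil m) (held j) \<le> 1 / real NB"
    by (cases j) (simp_all add: value_Fil held_simps divide_right_mono)
  then show ?thesis using i Fil by (simp add: held_value_own)
qed

text \<open>The \<open>2 * K * Suc b\<close> gadget players and controllers get \<open>x\<close>
  each, together \<open>1 - x\<close>.\<close>

lemma held_welfare: "(\<Sum>i\<in>players. value_of i (held i)) = real b + 2 - x"
proof -
  have "(\<Sum>i\<in>players. value_of i (held i)) = real b + (2 * real K * real (Suc b)) * x + 1"
    using NB_pos by (simp add: sum_players held_value_own algebra_simps del: sum.lessThan_Suc mult_Suc_right)
  then show ?thesis using x_total by (simp add: algebra_simps)
qed

section \<open>The division as intervals of the cake\<close>

definition M :: nat where "M = NB * W"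

text \<open>Cell \<open>s\<close> of block \<open>\<beta>\<close> becomes cell number
  \<open>s + \<beta> * W\<close> of the cake; \<open>div W\<close> and \<open>mod W\<close> recover
  block and position.\<close>

definition valn :: "player \<Rightarrow> real measure" where
  "valn i = cell_measure M (\<lambda>c. weight i (c div W) (c mod W))"

lemma M_pos: "0 < M"
  using NB_pos by (simp add: M_def W_def)

lemma sum_cells:
  "(\<Sum>c<M. weight i (c div W) (c mod W) * f c) = value_of i (\<lambda>\<beta> s. f (s + \<beta> * W))"
  unfolding M_def value_of_def by (subst sum_mult_product) simp

lemma valuation_valn:
  assumes "i \<in> players"
  shows "valuation (valn i)"
  unfolding valn_def
proof (rule valuation_cell_measure[OF M_pos weight_nonneg])
  show "(\<Sum>c<M. weight i (c div W) (c mod W)) = 1"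
    using sum_cells[of i "\<lambda>_. 1"] total_weight[OF assms] by simp
qed

lemma measure_valn:
  assumes "A \<in> sets borel" "A \<subseteq> {0..1}"
  shows "measure (valn i) A = value_of i (\<lambda>\<beta> s. overlap M A (s + \<beta> * W))"
  unfolding valn_def by (simp add: measure_cell_measure[OF M_pos weight_nonneg assms] sum_cells)

definition piece :: "player \<Rightarrow> real set" where
  "piece i = {real (blk i * W + start i) / real M <..< real (blk i * W + stop i) / real M}"

lemma block_end_le: "\<beta> < \<beta>' \<Longrightarrow> u \<le> W \<Longrightarrow> \<beta> * W + u \<le> \<beta>' * W + w"
proof -
  assume "\<beta> < \<beta>'" "u \<le> W"
  then have "\<beta> * W + u \<le> Suc \<beta> * W" by simp
  also have "\<dots> \<le> \<beta>' * W" using \<open>\<beta> < \<beta>'\<close> by (intro mult_le_mono1) simp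
  finally show ?thesis by simp
qed

lemma overlap_piece:
  assumes "i \<in> players" "s < W"
  shows "overlap M (piece i) (s + \<beta> * W) = held i \<beta> s"
proof -
  have "blk i * W + start i \<le> s + \<beta> * W \<and> s + \<beta> * W < blk i * W + stop i
      \<longleftrightarrow> \<beta> = blk i \<and> start i \<le> s \<and> s < stop i"
  proof (cases \<beta> "blk i" rule: linorder_cases)
    case less
    then show ?thesis using block_end_le[OF less, of "Suc s" "start i"] assms by auto
  next
    case greater
    then show ?thesis using block_end_le[OF greater stop_le_W[OF assms(1)], of s] by auto
  qed auto
  then show ?thesis unfolding piece_def by (simp only: overlap_open_interval[OF M_pos] held_def)
qed

lemma block_le_M: "\<beta> < NB \<Longrightarrow> u \<le> W \<Longrightarrow> \<beta> * W + u \<le> M"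
  using block_end_le[of \<beta> NB u 0] by (simp add: M_def)

lemma stop_le_M:
  assumes "i \<in> players"
  shows "blk i * W + stop i \<le> M"
  using assms blk_less stop_le_W by (intro block_le_M)

lemma piece_subset: "i \<in> players \<Longrightarrow> piece i \<subseteq> {0..1}"
proof -
  assume i: "i \<in> players"
  have "0 \<le> real (blk i * W + start i) / real M" "real (blk i * W + stop i) / real M \<le> 1"
    using stop_le_M[OF i] M_pos by (simp_all add: divide_le_eq del: of_nat_add of_nat_mult)
  then show ?thesis unfolding piece_def
    by (metis dual_order.trans greaterThanLessThan_subseteq_atLeastAtMost_iff)
qed

lemma measure_piece:
  assumes "j \<in> players"
  shows "measure (valn i) (piece j) = value_of i (held j)"
proof -
  have "piece j \<in> sets borel" by (simp add: piece_def)
  then show ?thesis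
    using assms by (simp add: measure_valn piece_subset value_of_def overlap_piece)
qed

lemma closure_piece:
  assumes "i \<in> players"
  shows "closure (piece i) = {real (blk i * W + start i) / real M .. real (blk i * W + stop i) / real M}"
  unfolding piece_def using start_less_stop[OF assms] M_pos
  by (intro closure_greaterThanLessThan) (simp add: divide_strict_right_mono)

fun dump_interval :: "nat \<times> nat \<times> nat \<Rightarrow> real set" where
  "dump_interval (\<beta>, u, w) = {real (\<beta> * W + u) / real M <..< real (\<beta> * W + w) / real M}"

lemma Ioo_disjoint:
  assumes "u2 \<le> l1 \<or> u1 \<le> (l2 :: nat)"
  shows "{real l1 / real M <..< real u1 / real M} \<inter> {real l2 / real M <..< real u2 / real M} = {}"
proof -
  have "real u2 / real M \<le> real l1 / real M \<or> real u1 / real M \<le> real l2 / real M"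
    using assms by (auto intro!: divide_right_mono)
  then show ?thesis by auto
qed

lemma segments_disjoint:
  assumes "\<beta> = \<beta>' \<longrightarrow> w' \<le> u \<or> w \<le> u'" "w \<le> W" "w' \<le> W"
  shows "\<beta>' * W + w' \<le> \<beta> * W + u \<or> \<beta> * W + w \<le> \<beta>' * W + u'"
  using assms block_end_le[of \<beta> \<beta>' w u'] block_end_le[of \<beta>' \<beta> w' u]
  by (cases \<beta> \<beta>' rule: linorder_cases) auto

lemma piece_disjoint:
  assumes "i \<in> players" "j \<in> players" "i \<noteq> j"
  shows "piece i \<inter> piece j = {}"
  unfolding piece_def
  by (intro Ioo_disjoint segments_disjoint) (use assms pieces_disjoint stop_le_W in auto)

lemma unallocated_pieces:
  "{0..1} - (\<Union>i\<in>players. closure (piece i)) = (\<Union>d\<in>dumps. dump_interval d)"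
proof (intro equalityI subsetI)
  fix t assume t: "t \<in> {0..1} - (\<Union>i\<in>players. closure (piece i))"
  have not_in: "\<not> (real (blk i * W + start i) \<le> t * real M \<and> t * real M \<le> real (blk i * W + stop i))"
    if "i \<in> players" for i
    using t that closure_piece[OF that] M_pos
    by (auto simp: divide_le_eq le_divide_eq simp del: of_nat_add of_nat_mult)
  define c where "c = nat \<lfloor>t * real M\<rfloor>"
  have tM: "0 \<le> t * real M" "t * real M \<le> real M" using t by (auto simp: mult_left_le_one_le)
  have c: "real c \<le> t * real M" "t * real M < real c + 1" using tM by (auto simp: c_def)
  \<comment> \<open>Only the point 1 would give \<open>c = M\<close>, and it lies in the closed
    piece of the last controller.\<close>
  have "c \<noteq> M"
  proof
    assume "c = M"
    define m where "m = K * Suc b - 1"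
    have m: "Con m \<in> players" "Suc (CB m) = NB"
      using K by (auto simp: m_def block_defs)
    then have "blk (Con m) * W + stop (Con m) = M" by (simp add: M_def m(2)[symmetric])
    moreover have "blk (Con m) * W + start (Con m) \<le> M"
      using stop_le_M[OF m(1)] start_less_stop[OF m(1)] by linarith
    moreover have "t * real M = real M" using tM c \<open>c = M\<close> by simp
    ultimately show False using not_in[OF m(1)] by (simp only: of_nat_le_iff order_refl simp_thms)
  qed
  moreover have "c \<le> M" using tM c by linarith
  ultimately have cM: "c < M" by simp
  define \<beta> s where "\<beta> = c div W" and "s = c mod W"
  have "0 < W" by (simp add: W_def)
  then have cs: "c = \<beta> * W + s" "s < W" by (simp_all only: \<beta>_def s_def div_mult_mod_eq mod_less_divisor)
  have "\<beta> < NB" using cM by (simp add: \<beta>_def M_def less_mult_imp_div_less)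
  then show "t \<in> (\<Union>d\<in>dumps. dump_interval d)" using cs(2)
  proof (cases rule: cell_cases)
    case (piece i)
    have "real (blk i * W + start i) \<le> t * real M"
      using c cs piece by (auto intro: order_trans[rotated])
    moreover have "t * real M \<le> real (blk i * W + stop i)"
    proof -
      have "Suc c \<le> blk i * W + stop i" using cs piece by auto
      then have "real c + 1 \<le> real (blk i * W + stop i)" by linarith
      then show ?thesis using c by linarith
    qed
    ultimately show ?thesis using not_in[OF piece(1)] by simp
  next
    case (dump u w)
    obtain i where i: "i \<in> players" "blk i = \<beta>" "stop i = u" by (rule dump_pred[OF dump(1)])
    have "real (blk i * W + start i) \<le> t * real M"
      using start_less_stop[OF i(1)] i dump cs c by (auto intro: order_trans[rotated])
    \<comment> \<open>The point is to the right of the start of piece \<open>i\<close> but outside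
      its closure, hence strictly beyond its stop, where the dumped interval begins.\<close>
    then have "real (\<beta> * W + u) < t * real M" using not_in[OF i(1)] i by simp
    moreover have "t * real M < real (\<beta> * W + w)"
    proof -
      have "Suc c \<le> \<beta> * W + w" using cs dump by auto
      then have "real c + 1 \<le> real (\<beta> * W + w)" by linarith
      then show ?thesis using c by linarith
    qed
    ultimately have "t \<in> dump_interval (\<beta>, u, w)"
      using M_pos by (simp add: less_divide_eq divide_less_eq del: of_nat_add of_nat_mult)
    then show ?thesis using dump by blast
  qed
next
  fix t assume "t \<in> (\<Union>d\<in>dumps. dump_interval d)"
  then obtain \<beta> u w where d: "(\<beta>, u, w) \<in> dumps" and "t \<in> dump_interval (\<beta>, u, w)" by auto
  then have t: "real (\<beta> * W + u) / real M < t" "t < real (\<beta> * W + w) / real M" by auto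
  have "\<beta> * W + w \<le> M" using dumps_bounds[OF d] by (intro block_le_M)
  then have "real (\<beta> * W + w) / real M \<le> 1" using M_pos by (simp add: divide_le_eq del: of_nat_add of_nat_mult)
  moreover have "0 \<le> real (\<beta> * W + u) / real M" by simp
  ultimately have "t \<in> {0..1}" using t by (meson atLeastAtMost_iff less_imp_le order_trans)
  moreover have "t \<notin> closure (piece i)" if i: "i \<in> players" for i
  proof -
    have "blk i * W + stop i \<le> \<beta> * W + u \<or> \<beta> * W + w \<le> blk i * W + start i"
      using dump_piece_disjoint[OF d i] dumps_bounds[OF d] stop_le_W[OF i]
      by (intro segments_disjoint) auto
    then have "real (blk i * W + stop i) / real M \<le> real (\<beta> * W + u) / real M
        \<or> real (\<beta> * W + w) / real M \<le> real (blk i * W + start i) / real M"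
      by (auto intro!: divide_right_mono simp del: of_nat_add of_nat_mult)
    then show ?thesis using t closure_piece[OF i] by (auto simp del: of_nat_add of_nat_mult)
  qed
  ultimately show "t \<in> {0..1} - (\<Union>i\<in>players. closure (piece i))" by blast
qed

lemma dump_interval_nonempty:
  assumes "d \<in> dumps"
  shows "dump_interval d \<noteq> {}"
proof -
  obtain \<beta> u w where d: "d = (\<beta>, u, w)" by (cases d)
  then have "real (\<beta> * W + u) / real M < real (\<beta> * W + w) / real M"
    using dumps_bounds[of \<beta> u w] assms M_pos by (intro divide_strict_right_mono) auto
  then show ?thesis using d by simp
qed

lemma dump_interval_disjoint:
  assumes "d \<in> dumps" "d' \<in> dumps" "d \<noteq> d'"
  shows "dump_interval d \<inter> dump_interval d' = {}"
proof -
  obtain \<beta> u w \<beta>' u' w' where d: "d = (\<beta>, u, w)" "d' = (\<beta>', u', w')" by (cases d, cases d')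
  have "\<beta> = \<beta>' \<longrightarrow> w' \<le> u \<or> w \<le> u'" using dumps_disjoint[of \<beta> u w u' w'] assms d by auto
  then show ?thesis unfolding d dump_interval.simps
    using dumps_bounds assms d by (intro Ioo_disjoint segments_disjoint) auto
qed

lemma card_dumps: "card dumps = z + K * b"
proof -
  have "card dumps = card ((\<lambda>m. (m, 1 :: nat, W)) ` {..<z})
      + card ((\<lambda>(g, q). (ZB g, Suc (Suc (2 * q)), Suc (Suc (Suc (2 * q))))) ` ({..<K} \<times> {..<b}))"
    unfolding dumps_def by (intro card_Un_disjoint) (use z in \<open>auto simp: block_defs\<close>)
  also have "card ((\<lambda>m. (m, 1 :: nat, W)) ` {..<z}) = z"
    by (subst card_image) (auto simp: inj_on_def)
  also have "card ((\<lambda>(g, q). (ZB g, Suc (Suc (2 * q)), Suc (Suc (Suc (2 * q))))) ` ({..<K} \<times> {..<b})) = K * b"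
    by (subst card_image) (auto simp: inj_on_def block_defs)
  finally show ?thesis .
qed

text \<open>Disjoint nonempty open intervals are the components of their union, and each element of
  \<open>dumps\<close> contributes one.\<close>

lemma components_unallocated:
  "card (components ({0..1} - (\<Union>i\<in>players. closure (piece i)))) = z + K * b"
proof -
  have "components ({0..1} - (\<Union>i\<in>players. closure (piece i))) = dump_interval ` dumps"
    unfolding unallocated_pieces
  proof (rule components_open_unique)
    show "disjoint (dump_interval ` dumps)"
    proof (rule disjointI)
      fix X Y assume "X \<in> dump_interval ` dumps" "Y \<in> dump_interval ` dumps" "X \<noteq> Y"
      then obtain d d' where "d \<in> dumps" "d' \<in> dumps" "X = dump_interval d" "Y = dump_interval d'" "d \<noteq> d'"
        by blast
      then show "X \<inter> Y = {}" using dump_interval_disjoint by simp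
    qed
  next
    fix X assume "X \<in> dump_interval ` dumps"
    then obtain d where d: "d \<in> dumps" "X = dump_interval d" by blast
    then show "open X \<and> connected X \<and> X \<noteq> {}"
      using dump_interval_nonempty[of d] by (cases d) (auto simp del: greaterThanLessThan_empty_iff)
  qed simp
  moreover have "inj_on dump_interval dumps"
  proof (rule inj_onI, rule ccontr)
    fix d d' assume d: "d \<in> dumps" "d' \<in> dumps" "dump_interval d = dump_interval d'" "d \<noteq> d'"
    then show False
      using dump_interval_disjoint[OF d(1,2,4)] dump_interval_nonempty[OF d(1)] by simp
  qed
  ultimately show ?thesis by (simp add: card_image card_dumps)
qed

end


section \<open>The dumping paradox\<close>

context dumping_cake
begin

lemma slot_before_flat:
  assumes "slot_before \<beta> s \<beta>' s'" "s < W"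
  shows "s + \<beta> * W < s' + \<beta>' * W"
  using assms block_end_le[of \<beta> \<beta>' "Suc s" s'] by (auto simp: slot_before_def)

text \<open>The numbering \<open>h\<close> turns the pieces into covered fractions \<open>ov\<close>
  that satisfy \<open>dumping_overlap\<close>, and \<open>welfare_le\<close> applies.\<close>

lemma complete_welfare_le:
  assumes h: "bij_betw h {..<n} players"
    and X: "complete_div n X" "envy_free n (\<lambda>i. valn (h i)) X"
  shows "util_welfare n (\<lambda>i. valn (h i)) X \<le> real b / real (Suc K) + 2"
proof -
  define h' where "h' = inv_into {..<n} h"
  have h': "bij_betw h' players {..<n}" unfolding h'_def by (rule bij_betw_inv_into[OF h])
  have hh: "h (h' i) = i" "h' i < n" if "i \<in> players" for i
    using that h' bij_betw_inv_into_right[OF h] by (auto simp: h'_def bij_betw_def)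
  have "open_interval01 (X j)" if "j < n" for j
    using X that by (auto simp: complete_div_def division_def)
  then have XI: "\<exists>a b. 0 \<le> a \<and> b \<le> 1 \<and> X j = {a<..<b}" if "j < n" for j
    using that unfolding open_interval01_def by blast
  have Xb: "X j \<in> sets borel" "X j \<subseteq> {0..1}" if "j < n" for j
    using XI[OF that] by auto
  define ov where "ov i \<beta> s = overlap M (X (h' i)) (s + \<beta> * W)" for i \<beta> s
  have val: "measure (valn i) (X (h' j)) = value_of i (ov j)" if "j \<in> players" for i j
    using that hh Xb unfolding ov_def by (intro measure_valn) auto
  have "dumping_overlap b K L z ov"
  proof unfold_locales
    show "0 \<le> ov i \<beta> s" for i \<beta> s by (simp add: ov_def)
    show "(\<Sum>i\<in>players. ov i \<beta> s) = 1" if "\<beta> < NB" "s < W" for \<beta> s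
    proof -
      have "s + \<beta> * W < M" using block_le_M[of \<beta> "Suc s"] that by simp
      moreover have "(\<Sum>i\<in>players. ov i \<beta> s) = (\<Sum>j<n. overlap M (X j) (s + \<beta> * W))"
        unfolding ov_def by (rule sum.reindex_bij_betw[OF h'])
      ultimately show ?thesis using sum_overlap_complete[OF M_pos X(1)] by simp
    qed
    show "ov i \<beta> s = 1"
      if "i \<in> players" "0 < ov i \<beta>1 s1" "0 < ov i \<beta>2 s2" "slot_before \<beta>1 s1 \<beta> s"
        "slot_before \<beta> s \<beta>2 s2" "s1 < W" "s2 < W" "s < W" for i \<beta>1 s1 \<beta>2 s2 \<beta> s
    proof -
      have "h' i < n" using hh(2) that(1) by simp
      then obtain l r where "X (h' i) = {l<..<r}" using XI by blast
      then show ?thesis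
        unfolding ov_def
        by (rule overlap_between[OF M_pos _ that(2,3)[unfolded ov_def] slot_before_flat slot_before_flat])
          (rule that)+
    qed
    show "value_of i (ov j) \<le> value_of i (ov i)" if "i \<in> players" "j \<in> players" for i j
      using X(2) that hh by (auto simp: envy_free_def val[symmetric] dest: spec[of _ "h' i"])
  qed
  then have "(\<Sum>i\<in>players. value_of i (ov i)) \<le> real b / real (Suc K) + 2"
    by (rule dumping_overlap.welfare_le)
  moreover have "util_welfare n (\<lambda>i. valn (h i)) X = (\<Sum>i\<in>players. measure (valn (h (h' i))) (X (h' i)))"
    unfolding util_welfare_def by (rule sum.reindex_bij_betw[OF h', symmetric])
  ultimately show ?thesis by (simp add: hh val)
qed

lemma dumping_instance:
  assumes "n = b + 2 * K * Suc b + NB"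
  obtains v Y where "cake_instance n v" "partial_div n Y" "envy_free n v Y"
    "util_welfare n v Y = real b + 2 - x" "num_unallocated_intervals n Y = z + K * b"
    "\<And>X. complete_div n X \<Longrightarrow> envy_free n v X \<Longrightarrow> util_welfare n v X \<le> real b / real (Suc K) + 2"
proof -
  obtain h where h: "bij_betw h {..<n} players"
    using ex_bij_betw_nat_finite[OF finite_players] by (auto simp: card_players assms atLeast0LessThan)
  then have hp: "h i \<in> players" if "i < n" for i using that by (auto simp: bij_betw_def)
  have inj: "h i \<noteq> h j" if "i < n" "j < n" "i \<noteq> j" for i j
    using h that by (auto simp: bij_betw_def inj_on_def)
  let ?v = "\<lambda>i. valn (h i)" and ?Y = "\<lambda>i. piece (h i)"
  have "cake_instance n ?v" using hp valuation_valn by (simp add: cake_instance_def)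
  moreover have Y: "division n ?Y"
    unfolding division_def
  proof (intro conjI allI impI)
    fix i assume i: "i < n"
    let ?l = "real (blk (h i) * W + start (h i)) / real M"
      and ?r = "real (blk (h i) * W + stop (h i)) / real M"
    have "?r \<le> 1" using stop_le_M[OF hp[OF i]] M_pos by (simp add: divide_le_eq del: of_nat_add of_nat_mult)
    moreover have "0 \<le> ?l" by simp
    ultimately show "open_interval01 (?Y i)" unfolding open_interval01_def piece_def by blast
  qed (use piece_disjoint hp inj in auto)
  have "(\<Union>i<n. closure (?Y i)) = (\<Union>i\<in>players. closure (piece i))"
    using bij_betw_imp_surj_on[OF h, symmetric] by simp
  then have num: "num_unallocated_intervals n ?Y = z + K * b"
    using components_unallocated by (simp add: num_unallocated_intervals_def unallocated_def)
  moreover have "partial_div n ?Y"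
  proof -
    \<comment> \<open>If the closed pieces covered the cake, the unallocated set would be empty and
      have no components.\<close>
    have "z + K * b \<noteq> 0" using K b by simp
    then have "(\<Union>i<n. closure (?Y i)) \<noteq> {0..1}"
      using num by (auto simp: num_unallocated_intervals_def unallocated_def)
    then show ?thesis using Y by (simp add: partial_div_def)
  qed
  moreover have "envy_free n ?v ?Y"
    using held_envy_free hp by (simp add: envy_free_def measure_piece)
  moreover have "util_welfare n ?v ?Y = real b + 2 - x"
  proof -
    have "util_welfare n ?v ?Y = (\<Sum>i<n. value_of (h i) (held (h i)))"
      using hp by (simp add: util_welfare_def measure_piece)
    also have "\<dots> = (\<Sum>i\<in>players. value_of i (held i))" by (rule sum.reindex_bij_betw[OF h])
    finally show ?thesis by (simp add: held_welfare)
  qed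
  ultimately show thesis using that complete_welfare_le[OF h] by blast
qed

end

text \<open>With \<open>b = 2 * t - 2\<close> this compares the welfare bound for complete
  divisions, times the claimed ratio, with the welfare of the partial division. Since
  \<open>K + 1\<close> is at least \<open>(k + 1) / 2\<close>, a polynomial inequality
  remains.\<close>

lemma ratio_bound:
  fixes k t K x :: real
  assumes "8 \<le> k" "3 \<le> t" "k \<le> 2 * K + 1" "x * (2 * K * (2 * t - 1) + 1) = 1" "0 < x"
  shows "(k * t + 2 * t) / (k + 3 * t) * ((2 * t - 2) / (K + 1) + 2) \<le> 2 * t - x"
proof -
  have K: "3 < K" using assms by linarith
  have "(k - 1) * 5 \<le> (2 * K) * (2 * t - 1)" using assms by (intro mult_mono) auto
  then have "k + 1 \<le> 2 * K * (2 * t - 1) + 1" using assms by simp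
  then have "x * (k + 1) \<le> 1"
    using assms(4,5) by (metis less_eq_real_def mult_left_mono)
  then have "x * (k + 1) * (k + 3 * t) \<le> 1 * (k + 3 * t)"
    using assms by (intro mult_right_mono) auto
  moreover have "k + 3 * t \<le> 2 * t * (t * k - t + 2)"
  proof -
    have "3 * (k - 1) \<le> t * (k - 1)" using assms by (intro mult_right_mono) auto
    then have 1: "3 * (k - 1) + 2 \<le> t * k - t + 2" by (simp add: algebra_simps)
    have "3 * (3 * (k - 1) + 2) \<le> t * (t * k - t + 2)" using assms 1 by (intro mult_mono) auto
    moreover have "t * 3 \<le> t * (t * k - t + 2)" using assms 1 by (intro mult_left_mono) auto
    ultimately show ?thesis using assms by (simp add: algebra_simps)
  qed
  ultimately have "x * (k + 1) * (k + 3 * t) \<le> 2 * t * (t * k - t + 2)" by simp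
  \<comment> \<open>Apart from the term with \<open>x\<close>, the right side exceeds the left by
    exactly \<open>2 * t * (t * k - t + 2)\<close>.\<close>
  then have main: "(k * t + 2 * t) * (4 * (t - 1) + 2 * (k + 1)) \<le> (2 * t - x) * ((k + 3 * t) * (k + 1))"
    by (simp add: algebra_simps)
  have "(2 * t - 2) / (K + 1) \<le> (2 * t - 2) / ((k + 1) / 2)"
    using assms by (intro divide_left_mono mult_pos_pos) auto
  also have "\<dots> + 2 = (4 * (t - 1) + 2 * (k + 1)) / (k + 1)"
    using assms by (simp add: field_simps)
  finally have "(k * t + 2 * t) / (k + 3 * t) * ((2 * t - 2) / (K + 1) + 2)
      \<le> (k * t + 2 * t) / (k + 3 * t) * ((4 * (t - 1) + 2 * (k + 1)) / (k + 1))"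
    using assms by (intro mult_left_mono divide_nonneg_nonneg add_nonneg_nonneg mult_nonneg_nonneg) auto
  also have "\<dots> = (k * t + 2 * t) * (4 * (t - 1) + 2 * (k + 1)) / ((k + 3 * t) * (k + 1))" by simp
  also have "\<dots> \<le> 2 * t - x"
    using main assms by (subst divide_le_eq) (auto intro!: mult_pos_pos add_pos_pos)
  finally show ?thesis .
qed

section \<open>Choice of the parameters\<close>

lemma dumping_paradox_instance:
  fixes k t :: nat
  assumes k: "8 \<le> k" and t: "3 \<le> t"
  defines "n \<equiv> 2 * k * (3 * t - 2)" and "\<alpha> \<equiv> real (k * t + 2 * t) / real (k + 3 * t)"
  obtains v Y where "cake_instance n v" "1 < \<alpha>" "dumping_witness n v \<alpha> Y"
    "num_unallocated_intervals n Y = k * (t - 1)"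
proof -
  \<comment> \<open>With \<open>2 * u\<close> big players there are \<open>K * (2 * u)\<close>
    crumbs. For odd \<open>k\<close> this is \<open>u\<close> short of \<open>k * (t - 1)\<close>,
    and dumping in \<open>r * u\<close> plain blocks makes up for it.\<close>
  define K r u where "K = k div 2" and "r = k mod 2" and "u = t - 1"
  have kr: "k = 2 * K + r" "r \<le> 1" by (auto simp: K_def r_def)
  have tu: "t = Suc u" "2 \<le> u" using t by (auto simp: u_def)
  have K4: "4 \<le> K" using k by (simp add: K_def)
  \<comment> \<open>This is the number of plain blocks for which the players number exactly
    \<open>n\<close>.\<close>
  define L where "L = 6 * (K * u) + 6 * (r * u) + 2 * r - 4 * u"
  have Ku: "4 * u \<le> K * u" "K * 2 \<le> K * u"
    by (intro mult_le_mono1 mult_le_mono2 K4 tu)+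
  then have L_eq: "L + 4 * u = 6 * (K * u) + 6 * (r * u) + 2 * r" unfolding L_def by linarith
  interpret dumping_cake "2 * u" K L "r * u"
  proof
    show "2 \<le> K" "1 \<le> 2 * u" using K4 tu by auto
    have "2 * K * Suc (2 * u) = 4 * (K * u) + 2 * K" by (simp add: algebra_simps)
    moreover have "2 * K < 2 * (K * u)" using Ku K4 by linarith
    ultimately show "2 * K * Suc (2 * u) < L + 2 * (2 * u)" using L_eq by linarith
    show "r * u \<le> L" using L_eq Ku by linarith
  qed
  have n: "n = 2 * u + 2 * K * Suc (2 * u) + NB"
  proof -
    have "n = (4 * K + 2 * r) * (3 * u + 1)" by (simp add: n_def kr(1) tu(1) algebra_simps)
    also have "\<dots> = 12 * (K * u) + 4 * K + 6 * (r * u) + 2 * r" by (simp add: algebra_simps)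
    also have "\<dots> = 2 * u + 2 * K * Suc (2 * u) + NB"
    proof -
      have "2 * u + 2 * K * Suc (2 * u) + NB = L + 4 * u + 6 * (K * u) + 4 * K"
        unfolding NB_def by (simp add: algebra_simps)
      then show ?thesis using L_eq by simp
    qed
    finally show ?thesis .
  qed
  from dumping_instance[OF n] obtain v Y where vY: "cake_instance n v" "partial_div n Y" "envy_free n v Y"
    "util_welfare n v Y = real (2 * u) + 2 - x" "num_unallocated_intervals n Y = r * u + K * (2 * u)"
    "\<And>X. complete_div n X \<Longrightarrow> envy_free n v X \<Longrightarrow> util_welfare n v X \<le> real (2 * u) / real (Suc K) + 2"
    by blast
  have Y: "util_welfare n v Y = 2 * real t - x" using vY(4) tu by simp
  have a0: "0 \<le> \<alpha>" by (simp add: \<alpha>_def)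
  have "\<alpha> * (real (2 * u) / real (Suc K) + 2) \<le> 2 * real t - x"
  proof -
    have "x * (2 * real K * (2 * real t - 1) + 1) = 1"
      using x_total tu by (simp add: algebra_simps)
    moreover have "real k \<le> 2 * real K + 1" using kr by simp
    ultimately have "(real k * real t + 2 * real t) / (real k + 3 * real t)
        * ((2 * real t - 2) / (real K + 1) + 2) \<le> 2 * real t - x"
      using k t x_pos by (intro ratio_bound) auto
    moreover have "real (2 * u) / real (Suc K) = (2 * real t - 2) / (real K + 1)" using tu by (simp add: add.commute)
    ultimately show ?thesis by (simp add: \<alpha>_def)
  qed
  then have "\<alpha> * util_welfare n v X \<le> util_welfare n v Y" if "complete_div n X" "envy_free n v X" for X
    using mult_left_mono[OF vY(6)[OF that] a0] Y by linarith
  then have "dumping_witness n v \<alpha> Y" using vY by (auto simp: dumping_witness_def)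
  moreover have "r * u + K * (2 * u) = k * (t - 1)" using tu by (simp add: kr(1) algebra_simps)
  moreover have "1 < \<alpha>"
  proof -
    have "2 * k \<le> u * k" "8 * u \<le> k * u" using tu k by auto
    then have "Suc u < k * u" using tu by linarith
    then have "k + 3 * t < k * t + 2 * t" using tu(1) by simp
    then have "real (k + 3 * t) < real (k * t + 2 * t)" by (simp only: of_nat_less_iff)
    moreover have "0 < real (k + 3 * t)" using k by simp
    ultimately show ?thesis by (simp add: \<alpha>_def less_divide_eq_1_pos del: of_nat_add of_nat_mult)
  qed
  ultimately show thesis using that vY by metis
qed

theorem theorem1:
  shows "(\<forall>k t :: nat. k \<ge> 8 \<longrightarrow> t \<ge> 3 \<longrightarrow>
           (let n = 2 * k * (3 * t - 2) in
            \<exists>v \<alpha>. cake_instance n v \<and> \<alpha> \<ge> real (k * t + 2 * t) / real (k + 3 * t)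
                 \<and> util_dumping_paradox n v \<alpha>
                 \<and> (\<exists>Y. dumping_witness n v \<alpha> Y
                        \<and> num_unallocated_intervals n Y = k * (t - 1))))
       \<and> (\<exists>c::real. c > 0 \<and> (\<forall>N. \<exists>n \<ge> N. \<exists>v \<alpha>. cake_instance n v
             \<and> util_dumping_paradox n v \<alpha> \<and> \<alpha> \<ge> c * sqrt (real n)))"
proof (intro conjI allI impI)
  fix k t :: nat
  assume kt: "8 \<le> k" "3 \<le> t"
  obtain v Y where "cake_instance (2 * k * (3 * t - 2)) v"
    "1 < real (k * t + 2 * t) / real (k + 3 * t)"
    "dumping_witness (2 * k * (3 * t - 2)) v (real (k * t + 2 * t) / real (k + 3 * t)) Y"
    "num_unallocated_intervals (2 * k * (3 * t - 2)) Y = k * (t - 1)"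
    by (rule dumping_paradox_instance[OF kt])
  then show "let n = 2 * k * (3 * t - 2) in
            \<exists>v \<alpha>. cake_instance n v \<and> \<alpha> \<ge> real (k * t + 2 * t) / real (k + 3 * t)
                 \<and> util_dumping_paradox n v \<alpha>
                 \<and> (\<exists>Y. dumping_witness n v \<alpha> Y
                        \<and> num_unallocated_intervals n Y = k * (t - 1))"
    unfolding Let_def util_dumping_paradox_def by blast
next
  show "\<exists>c::real. c > 0 \<and> (\<forall>N. \<exists>n \<ge> N. \<exists>v \<alpha>. cake_instance n v
             \<and> util_dumping_paradox n v \<alpha> \<and> \<alpha> \<ge> c * sqrt (real n))"
  \<comment> \<open>For \<open>t = k\<close> the ratio equals \<open>(k + 2) / 4\<close>, and
    \<open>n\<close> is at most \<open>(3 * k)^2\<close>, so \<open>sqrt n / 12\<close> is at most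
    \<open>k / 4\<close>.\<close>
  proof (intro exI[of _ "1 / 12 :: real"] conjI allI)
    fix N :: nat
    define k where "k = N + 8"
    have k: "8 \<le> k" "3 \<le> k" by (auto simp: k_def)
    let ?n = "2 * k * (3 * k - 2)" and ?\<alpha> = "real (k * k + 2 * k) / real (k + 3 * k)"
    obtain v Y where vY: "cake_instance ?n v" "1 < ?\<alpha>" "dumping_witness ?n v ?\<alpha> Y"
      by (rule dumping_paradox_instance[OF k])
    have "k * 1 \<le> k * (3 * k - 2)" using k by (intro mult_le_mono2) auto
    then have "k \<le> ?n" by simp
    then have "N \<le> ?n" unfolding k_def by linarith
    moreover have "1 / 12 * sqrt (real ?n) \<le> ?\<alpha>"
    proof -
      have "?n \<le> 2 * k * (3 * k)" by (intro mult_le_mono2) simp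
      also have "\<dots> \<le> (3 * k)\<^sup>2" by (simp add: power2_eq_square)
      finally have "real ?n \<le> (3 * real k)\<^sup>2"
        by (metis of_nat_le_iff of_nat_mult of_nat_numeral of_nat_power)
      then have "sqrt (real ?n) \<le> 3 * real k" by (intro real_le_lsqrt) auto
      then have "1 / 12 * sqrt (real ?n) \<le> 1 / 12 * (3 * real k)" by (rule mult_left_mono) simp
      also have "\<dots> \<le> (real k + 2) / 4" by simp
      also have "(real k + 2) / 4 = ?\<alpha>" using k by (simp add: field_simps)
      finally show ?thesis .
    qed
    ultimately show "\<exists>n \<ge> N. \<exists>v \<alpha>. cake_instance n v
        \<and> util_dumping_paradox n v \<alpha> \<and> \<alpha> \<ge> 1 / 12 * sqrt (real n)"
      using vY unfolding util_dumping_paradox_def by blast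
  qed simp
qed

end
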